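(* Let $K$ be a simplicial complex on the vertex set $[m]$. For $i=1,\ldots,m$, the space $\mathcal{Z}_K^i$ is obtained from $\mathcal{Z}_K^{i-1}$ by attaching a cone to the composite $$|\mathrm{Sd}\,K_I|*S^{i-1}\xrightarrow{\widehat{\varphi}_{K_I}}\mathcal{Z}_{K_I}^{i-1}\xrightarrow{\mathrm{incl}}\mathcal{Z}_K^{i-1}$$ for each $I\subset[m]$ with $|I|=i$.
   Context: Let $[m]=\{1,\ldots,m\}$, $m\ge 1$. $K$ is an abstract simplicial complex on the vertex set $[m]$ (so every $\{i\}$ is a simplex), $|K|$ is its geometric realization, and for $\emptyset\ne I\subset[m]$, $K_I=\{\sigma\in K\mid\sigma\subset I\}$ is the full subcomplex on $I$, a simplicial complex on the vertex set $I$. $\mathrm{Sd}\,K$ is the barycentric subdivision, whose vertices are the non-empty simplices of $K$; $\mathrm{Cone}(\mathrm{Sd}\,K)$ is the simplicial cone on it. $A*B$ denotes the join. The moment-angle complex is $\mathcal{Z}_K=\bigcup_{\sigma\in K}Y_1^\sigma\times\cdots\times Y_m^\sigma\subset(D^2)^m$ with $Y_i^\sigma=D^2$ for $i\in\sigma$ and $Y_i^\sigma=S^1$ for $i\notin\sigma$. Here $D^2$ is regarded as the reduced cone $CS^1=S^1\times[-1,1]/(S^1\times\{-1\}\cup\{*\}\times[-1,1])$, with base $S^1=S^1\times\{+1\}$ and with basepoint the collapsed point; the class of $(x,t)$ is written $(t,x)$. $\mathcal{Z}_K^{k}$ ($0\le k\le m$) is the subspace of points of $\mathcal{Z}_K$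 at least $m-k$ of whose coordinates are the basepoint. The same definitions apply to $K_I$ (with $[m]$ replaced by $I$ and $m$ by $|I|$), and $\mathcal{Z}_{K_I}$ is identified with the subspace of $\mathcal{Z}_K$ of points whose coordinates outside $I$ are the basepoint. Attaching maps: let $\mathrm{Cone}(i_c)\colon|\mathrm{Cone}(\mathrm{Sd}\,K)|\to[-1,1]^m$ be the map, affine on each simplex, sending the vertex $\sigma$ of $\mathrm{Sd}\,K$ to the point whose $i$-th coordinate is $-1$ for $i\in\sigma$ and $+1$ for $i\notin\sigma$, and sending the cone point to $(+1,\ldots,+1)$. Let $\Phi_K\colon|\mathrm{Cone}(\mathrm{Sd}\,K)|\times(S^1)^m\to\mathcal{Z}_K$ send $(y;x_1,\ldots,x_m)$ to $((t_1,x_1),\ldots,(t_m,x_m))$, where $(t_1,\ldots,t_m)=\mathrm{Cone}(i_c)(y)$. Let $q\colon D^m\to(S^1)^m$ be the characteristic map of the top cell of $(S^1)^m$ (mapping $S^{m-1}$ into the fat wedge, i.e. the subspace of points having at least one coordinate equal to the basepoint). The map $\Phi_K\circ(1\times q)$ restricts to a map $$\widehat{\varphi}_K\colon|\mathrm{Sd}\,K|*S^{m-1}=(|\mathrm{Cone}(\mathrm{Sd}\,K)|\times S^{m-1})\cup(|\mathrm{Sd}\,K|\times D^m)\to\mathcal{Z}_K^{m-1}.$$ Applying this to $K_I$ gives $\widehat{\varphi}_{K_I}\colon|\mathrm{Sd}\,K_I|*S^{|I|-1}\to\mathcal{Z}_{K_I}^{|I|-1}$. *)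

theory Defs
  imports "HOL-Analysis.Analysis"
begin

text \<open>The least equivalence relation on \<open>S\<close> containing \<open>r \<inter> S \<times> S\<close>.\<close>

definition equiv_gen :: "'a set \<Rightarrow> ('a \<times> 'a) set \<Rightarrow> ('a \<times> 'a) set" where
  "equiv_gen S r = ((r \<union> r\<inverse>) \<inter> S \<times> S)\<^sup>* \<inter> S \<times> S"

lemma equiv_equiv_gen: "equiv S (equiv_gen S r)"
proof (rule equivI)
  have "sym ((r \<union> r\<inverse>) \<inter> S \<times> S)"
    by (auto simp: sym_def)
  then show "sym (equiv_gen S r)"
    by (auto simp: equiv_gen_def intro!: sym_Int sym_rtrancl) (auto simp: sym_def)
  show "trans (equiv_gen S r)"
    by (auto simp: equiv_gen_def trans_def)
qed (auto simp: equiv_gen_def refl_on_def)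

definition quotient_class :: "'a topology \<Rightarrow> ('a \<times> 'a) set \<Rightarrow> 'a \<Rightarrow> 'a set" where
  "quotient_class X r x = equiv_gen (topspace X) r `` {x}"

definition quotient_topology :: "'a topology \<Rightarrow> ('a \<times> 'a) set \<Rightarrow> 'a set topology" where
  "quotient_topology X r =
     topology (\<lambda>U. U \<subseteq> topspace X // equiv_gen (topspace X) r \<and> openin X (\<Union>U))"

lemma istopology_quotient:
  "istopology (\<lambda>U. U \<subseteq> topspace X // equiv_gen (topspace X) r \<and> openin X (\<Union>U))"
proof -
  let ?Q = "topspace X // equiv_gen (topspace X) r"
  have Int: "\<Union>(U \<inter> V) = \<Union>U \<inter> \<Union>V" if "U \<subseteq> ?Q" "V \<subseteq> ?Q" for U V
  proof
    show "\<Union>U \<inter> \<Union>V \<subseteq> \<Union>(U \<inter> V)"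
    proof
      fix x assume "x \<in> \<Union>U \<inter> \<Union>V"
      then obtain A B where "A \<in> U" "B \<in> V" "x \<in> A" "x \<in> B" by blast
      moreover have "A = B"
        using quotient_disj[OF equiv_equiv_gen, of A "topspace X" r B] that calculation by blast
      ultimately show "x \<in> \<Union>(U \<inter> V)" by blast
    qed
  qed blast
  have Un: "\<Union>(\<Union>\<U>) = \<Union>(Union ` \<U>)" for \<U> :: "'a set set set"
    by blast
  show ?thesis
    unfolding istopology_def
  proof (intro conjI allI impI)
    fix U V
    assume U: "U \<subseteq> ?Q \<and> openin X (\<Union>U)" and V: "V \<subseteq> ?Q \<and> openin X (\<Union>V)"
    then show "U \<inter> V \<subseteq> ?Q" by blast
    have "\<Union>(U \<inter> V) = \<Union>U \<inter> \<Union>V" using Int U V by blast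
    then show "openin X (\<Union>(U \<inter> V))" using U V by (metis openin_Int)
  next
    fix \<U> assume \<U>: "\<forall>U\<in>\<U>. U \<subseteq> ?Q \<and> openin X (\<Union>U)"
    then show "\<Union>\<U> \<subseteq> ?Q" by blast
    show "openin X (\<Union>(\<Union>\<U>))" unfolding Un using \<U> by (intro openin_Union) auto
  qed
qed

lemma openin_quotient_topology:
  "openin (quotient_topology X r) U \<longleftrightarrow>
     U \<subseteq> topspace X // equiv_gen (topspace X) r \<and> openin X (\<Union>U)"
  by (simp add: quotient_topology_def istopology_quotient)

lemma topspace_quotient_topology:
  "topspace (quotient_topology X r) = topspace X // equiv_gen (topspace X) r"
proof -
  have "\<Union>(topspace X // equiv_gen (topspace X) r) = topspace X"
    by (rule Union_quotient[OF equiv_equiv_gen])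
  then have "openin (quotient_topology X r) (topspace X // equiv_gen (topspace X) r)"
    by (simp add: openin_quotient_topology)
  then have "topspace X // equiv_gen (topspace X) r \<subseteq> topspace (quotient_topology X r)"
    by (rule openin_subset)
  moreover have "topspace (quotient_topology X r) \<subseteq> topspace X // equiv_gen (topspace X) r"
    using openin_topspace[of "quotient_topology X r"] unfolding openin_quotient_topology by blast
  ultimately show ?thesis by blast
qed

lemma quotient_map_quotient_class:
  "quotient_map X (quotient_topology X r) (quotient_class X r)"
proof -
  let ?E = "equiv_gen (topspace X) r"
  have img: "quotient_class X r ` topspace X = topspace X // ?E"
    by (auto simp: quotient_class_def quotient_def)
  moreover have "{x \<in> topspace X. quotient_class X r x \<in> U} = \<Union>U" if "U \<subseteq> topspace X // ?E" for U
  proof (intro set_eqI iffI)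
    fix x assume x: "x \<in> {x \<in> topspace X. quotient_class X r x \<in> U}"
    then have "x \<in> quotient_class X r x"
      unfolding quotient_class_def by (intro equiv_class_self[OF equiv_equiv_gen]) simp
    with x show "x \<in> \<Union>U" by blast
  next
    fix x assume "x \<in> \<Union>U"
    then obtain A where A: "A \<in> U" "x \<in> A" by blast
    then have "A \<in> topspace X // ?E"
      using that by blast
    then obtain w where w: "w \<in> topspace X" "A = ?E `` {w}"
      by (rule quotientE)
    have wx: "(w, x) \<in> ?E"
      using A w by simp
    have "x \<in> topspace X"
      using wx by (simp add: equiv_gen_def)
    moreover have "A = quotient_class X r x"
      unfolding quotient_class_def using equiv_class_eq[OF equiv_equiv_gen wx] w(2) by simp
    ultimately show "x \<in> {x \<in> topspace X. quotient_class X r x \<in> U}"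
      using A by simp
  qed
  ultimately show ?thesis
    unfolding quotient_map_def topspace_quotient_topology openin_quotient_topology
    by (metis (no_types, lifting))
qed

text \<open>Binary disjoint union of spaces of possibly different types
  (\<^const>\<open>sum_topology\<close> requires all summands to have the same type).\<close>

definition coprod_topology :: "'a topology \<Rightarrow> 'b topology \<Rightarrow> ('a + 'b) topology" where
  "coprod_topology X Y =
     topology (\<lambda>U. openin X (Inl -` U) \<and> openin Y (Inr -` U))"

lemma openin_coprod_topology:
  "openin (coprod_topology X Y) U \<longleftrightarrow> openin X (Inl -` U) \<and> openin Y (Inr -` U)"
proof -
  have "istopology (\<lambda>U. openin X (Inl -` U) \<and> openin Y (Inr -` U))"
    by (auto simp: istopology_def vimage_Union intro!: openin_Int openin_Union)
  then show ?thesis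
    by (simp add: coprod_topology_def)
qed

lemma topspace_coprod_topology:
  "topspace (coprod_topology X Y) = topspace X <+> topspace Y"
proof
  have "Inl -` (topspace X <+> topspace Y) = topspace X"
    "Inr -` (topspace X <+> topspace Y) = topspace Y" by auto
  then show "topspace X <+> topspace Y \<subseteq> topspace (coprod_topology X Y)"
    by (intro openin_subset) (simp add: openin_coprod_topology)
  show "topspace (coprod_topology X Y) \<subseteq> topspace X <+> topspace Y"
  proof
    fix z assume z: "z \<in> topspace (coprod_topology X Y)"
    have X: "Inl -` topspace (coprod_topology X Y) \<subseteq> topspace X"
      and Y: "Inr -` topspace (coprod_topology X Y) \<subseteq> topspace Y"
      using openin_topspace[of "coprod_topology X Y"] unfolding openin_coprod_topology
      by (simp_all add: openin_subset)
    show "z \<in> topspace X <+> topspace Y"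
      using z X Y by (cases z) auto
  qed
qed

definition cone_rel :: "'a topology \<Rightarrow> (('a \<times> real) \<times> ('a \<times> real)) set" where
  "cone_rel A = (topspace A \<times> {1}) \<times> (topspace A \<times> {1})"

text \<open>The (unreduced) cone \<open>A \<times> [0,1] / A \<times> {1}\<close>, with base \<open>A \<times> {0}\<close>.\<close>

definition cone_space :: "'a topology \<Rightarrow> ('a \<times> real) set topology" where
  "cone_space A = quotient_topology (prod_topology A (top_of_set {0..1})) (cone_rel A)"

definition cone_class :: "'a topology \<Rightarrow> 'a \<times> real \<Rightarrow> ('a \<times> real) set" where
  "cone_class A = quotient_class (prod_topology A (top_of_set {0..1})) (cone_rel A)"

definition attach_sum ::
    "'x topology \<Rightarrow> 'j set \<Rightarrow> ('j \<Rightarrow> 'a topology) \<Rightarrow> ('x + 'j \<times> ('a \<times> real) set) topology" where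
  "attach_sum X J A = coprod_topology X (sum_topology (\<lambda>j. cone_space (A j)) J)"

definition attach_rel ::
    "'j set \<Rightarrow> ('j \<Rightarrow> 'a topology) \<Rightarrow> ('j \<Rightarrow> 'a \<Rightarrow> 'x)
      \<Rightarrow> (('x + 'j \<times> ('a \<times> real) set) \<times> ('x + 'j \<times> ('a \<times> real) set)) set" where
  "attach_rel J A f = {(Inr (j, cone_class (A j) (a, 0)), Inl (f j a)) | j a.
     j \<in> J \<and> a \<in> topspace (A j)}"

text \<open>The space \<open>Z\<close> is obtained from \<open>X\<close> by attaching, for each \<open>j \<in> J\<close>, a cone to the
  continuous map \<open>f j : A j \<rightarrow> X\<close>: there is a homeomorphism, relative to \<open>X \<subseteq> Z\<close>, from the
  disjoint union of \<open>X\<close> and all the cones, with bases glued to \<open>X\<close> along the \<open>f j\<close>, onto \<open>Z\<close>.\<close>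

definition obtained_by_attaching_cones ::
    "'x topology \<Rightarrow> 'x topology \<Rightarrow> 'j set \<Rightarrow> ('j \<Rightarrow> 'a topology) \<Rightarrow> ('j \<Rightarrow> 'a \<Rightarrow> 'x) \<Rightarrow> bool" where
  "obtained_by_attaching_cones Z X J A f \<longleftrightarrow>
     (\<forall>j\<in>J. continuous_map (A j) X (f j)) \<and>
     (\<exists>h. homeomorphic_map (quotient_topology (attach_sum X J A) (attach_rel J A f)) Z h \<and>
          (\<forall>x\<in>topspace X. h (quotient_class (attach_sum X J A) (attach_rel J A f) (Inl x)) = x))"

text \<open>The empty set is a simplex, and there are no ghost vertices.\<close>

definition abstract_complex :: "'v set \<Rightarrow> 'v set set \<Rightarrow> bool" where
  "abstract_complex V K \<longleftrightarrow>
     K \<subseteq> Pow V \<and> {} \<in> K \<and> (\<forall>\<sigma>\<in>K. \<forall>\<tau>\<subseteq>\<sigma>. \<tau> \<in> K) \<and> (\<forall>v\<in>V. {v} \<in> K)"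

definition full_subcomplex :: "'v set set \<Rightarrow> 'v set \<Rightarrow> 'v set set" where
  "full_subcomplex K I = {\<sigma> \<in> K. \<sigma> \<subseteq> I}"

lemma abstract_complex_full_subcomplex:
  "\<lbrakk>abstract_complex V K; I \<subseteq> V\<rbrakk> \<Longrightarrow> abstract_complex I (full_subcomplex K I)"
  by (auto simp: abstract_complex_def full_subcomplex_def)

text \<open>Simplices of the barycentric subdivision are chains of non-empty simplices.\<close>

definition Sd :: "'v set set \<Rightarrow> 'v set set set" where
  "Sd K = {c. finite c \<and> c \<subseteq> K - {{}} \<and> (\<forall>\<sigma>\<in>c. \<forall>\<tau>\<in>c. \<sigma> \<subseteq> \<tau> \<or> \<tau> \<subseteq> \<sigma>)}"

lemma abstract_complex_Sd:
  "abstract_complex V K \<Longrightarrow> abstract_complex (K - {{}}) (Sd K)"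
  unfolding abstract_complex_def
proof (intro conjI ballI allI impI)
  fix c d assume "c \<in> Sd K" "d \<subseteq> c"
  then show "d \<in> Sd K"
    by (simp add: Sd_def finite_subset[of d c] subset_iff)
qed (simp_all add: Sd_def subset_iff)

text \<open>The simplicial cone over \<open>L\<close>: the cone point is \<open>None\<close>, and \<open>cone_base L\<close> is the copy of
  \<open>L\<close> in it on the vertices \<open>Some v\<close>.\<close>

definition cone_base :: "'v set set \<Rightarrow> 'v option set set" where
  "cone_base L = (\<lambda>\<sigma>. Some ` \<sigma>) ` L"

definition simplicial_cone :: "'v set set \<Rightarrow> 'v option set set" where
  "simplicial_cone L = cone_base L \<union> insert None ` cone_base L"

text \<open>Geometric realization by barycentric coordinates, with the topology of pointwise convergence;
  this is the usual topology because only complexes with finitely many vertices are considered.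
  The realization of a subcomplex is a subset of the realization of the complex.\<close>

definition realization :: "'v set set \<Rightarrow> ('v \<Rightarrow> real) topology" where
  "realization L = subtopology (powertop_real UNIV)
     {y. (\<forall>v. 0 \<le> y v) \<and> {v. y v \<noteq> 0} \<in> L \<and> (\<Sum>v | y v \<noteq> 0. y v) = 1}"

definition disc :: "nat \<Rightarrow> (nat \<Rightarrow> real) topology" where
  "disc n = subtopology (Euclidean_space n) {x. (\<Sum>i<n. (x i)\<^sup>2) \<le> 1}"

text \<open>For \<open>n > 0\<close>, the join \<open>|L| * S\<^sup>n\<^sup>-\<^sup>1\<close> as
  \<open>(|Cone L| \<times> S\<^sup>n\<^sup>-\<^sup>1) \<union> (|L| \<times> D\<^sup>n) \<subseteq> |Cone L| \<times> D\<^sup>n\<close>.\<close>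

definition join_sphere :: "'v set set \<Rightarrow> nat \<Rightarrow> (('v option \<Rightarrow> real) \<times> (nat \<Rightarrow> real)) topology" where
  "join_sphere L n =
     subtopology (prod_topology (realization (simplicial_cone L)) (disc n))
       (topspace (realization (simplicial_cone L)) \<times> topspace (nsphere (n - 1)) \<union>
        topspace (realization (cone_base L)) \<times> topspace (disc n))"

abbreviation S1 :: "complex topology" where
  "S1 \<equiv> top_of_set (sphere 0 1)"

definition S1_cyl :: "(complex \<times> real) topology" where
  "S1_cyl = prod_topology S1 (top_of_set {-1..1})"

definition D2_rel :: "((complex \<times> real) \<times> (complex \<times> real)) set" where
  "D2_rel = (let C = sphere 0 1 \<times> {-1} \<union> {1} \<times> {-1..1} in C \<times> C)"

text \<open>\<open>D\<^sup>2\<close> as the reduced cone on \<open>S\<^sup>1\<close>, whose basepoint is \<open>1\<close>; \<open>D2_pt t x\<close> is the point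
  \<open>(t, x)\<close> of it.\<close>

definition D2 :: "(complex \<times> real) set topology" where
  "D2 = quotient_topology S1_cyl D2_rel"

definition D2_pt :: "real \<Rightarrow> complex \<Rightarrow> (complex \<times> real) set" where
  "D2_pt t x = quotient_class S1_cyl D2_rel (x, t)"

definition D2_base :: "(complex \<times> real) set" where
  "D2_base = D2_pt (-1) 1"

definition D2_circle :: "(complex \<times> real) set set" where
  "D2_circle = D2_pt 1 ` sphere 0 1"

definition moment_angle :: "nat set \<Rightarrow> nat set set \<Rightarrow> (nat \<Rightarrow> (complex \<times> real) set) topology" where
  "moment_angle I K = subtopology (product_topology (\<lambda>_. D2) I)
     (\<Union>\<sigma>\<in>K. \<Pi>\<^sub>E i\<in>I. if i \<in> \<sigma> then topspace D2 else D2_circle)"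

definition fat_wedge_filtration ::
    "nat set \<Rightarrow> nat set set \<Rightarrow> nat \<Rightarrow> (nat \<Rightarrow> (complex \<times> real) set) topology" where
  "fat_wedge_filtration I K k =
     subtopology (moment_angle I K) {z. card {i \<in> I. z i = D2_base} \<ge> card I - k}"

text \<open>For \<open>I \<subseteq> V\<close>, the inclusion of the moment-angle complex of \<open>K\<^sub>I\<close> into that of \<open>K\<close>.\<close>

definition base_extend ::
    "nat set \<Rightarrow> nat set \<Rightarrow> (nat \<Rightarrow> (complex \<times> real) set) \<Rightarrow> nat \<Rightarrow> (complex \<times> real) set" where
  "base_extend I V z = (\<lambda>i\<in>V. if i \<in> I then z i else D2_base)"

definition cone_ic_vertex :: "nat set option \<Rightarrow> nat \<Rightarrow> real" where
  "cone_ic_vertex v i = (case v of None \<Rightarrow> 1 | Some \<sigma> \<Rightarrow> if i \<in> \<sigma> then -1 else 1)"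

definition cone_ic :: "(nat set option \<Rightarrow> real) \<Rightarrow> nat \<Rightarrow> real" where
  "cone_ic y i = (\<Sum>v | y v \<noteq> 0. y v * cone_ic_vertex v i)"

definition Phi ::
    "nat set \<Rightarrow> (nat set option \<Rightarrow> real) \<times> (nat \<Rightarrow> complex) \<Rightarrow> nat \<Rightarrow> (complex \<times> real) set" where
  "Phi I = (\<lambda>(y, x). \<lambda>i\<in>I. D2_pt (cone_ic y i) (x i))"

definition torus :: "nat set \<Rightarrow> (nat \<Rightarrow> complex) topology" where
  "torus I = product_topology (\<lambda>_. S1) I"

definition torus_fat_wedge :: "nat set \<Rightarrow> (nat \<Rightarrow> complex) set" where
  "torus_fat_wedge I = {x \<in> topspace (torus I). \<exists>i\<in>I. x i = 1}"

text \<open>Characteristic maps of the top cell of the torus \<open>(S\<^sup>1)\<^sup>I\<close>, where \<open>I \<noteq> {}\<close> and \<open>S\<^sup>1\<close> has one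
  0-cell \<open>1\<close> and one 1-cell.\<close>

definition top_cell_map :: "nat set \<Rightarrow> ((nat \<Rightarrow> real) \<Rightarrow> nat \<Rightarrow> complex) \<Rightarrow> bool" where
  "top_cell_map I q \<longleftrightarrow>
     continuous_map (disc (card I)) (torus I) q \<and>
     q ` topspace (nsphere (card I - 1)) \<subseteq> torus_fat_wedge I \<and>
     homeomorphic_map
       (subtopology (disc (card I)) (topspace (disc (card I)) - topspace (nsphere (card I - 1))))
       (subtopology (torus I) (topspace (torus I) - torus_fat_wedge I)) q"

definition phi_hat ::
    "nat set \<Rightarrow> ((nat \<Rightarrow> real) \<Rightarrow> nat \<Rightarrow> complex)
      \<Rightarrow> (nat set option \<Rightarrow> real) \<times> (nat \<Rightarrow> real) \<Rightarrow> nat \<Rightarrow> (complex \<times> real) set" where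
  "phi_hat I q = (\<lambda>(y, u). Phi I (y, q u))"

end

theory Submission
  imports Defs
begin

text \<open>Let \<open>I\<close> have \<open>i\<close> elements, and let \<open>C\<close> be the cone on the realized barycentric subdivision of
  \<open>K\<^sub>I\<close>, with base \<open>B\<close>.  A point of the moment-angle complex whose coordinates off the basepoint are
  exactly those in \<open>I\<close> is given by pairs \<open>(t\<^sub>j, x\<^sub>j)\<close>, \<open>j \<in> I\<close>, with \<open>t\<^sub>j > -1\<close>, \<open>x\<^sub>j \<noteq> 1\<close> and
  \<open>{j. t\<^sub>j < 1} \<in> K\<^sub>I\<close>, and these pairs are unique (\<open>D2_pt_eq_iff\<close>).  The circle components range
  over the complement of the fat wedge, which \<open>q\<close> identifies with the open disc.  The cone parameters
  range over the image of \<open>C - B\<close> under \<open>Cone(i\<^sub>c)\<close>, which is injective.  So the map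
  \<open>\<Phi> \<circ> (1 \<times> q)\<close> on \<open>C \<times> D\<^sup>i\<close> carries the complement of the join \<open>(C \<times> S\<^sup>i\<^sup>-\<^sup>1) \<union> (B \<times> D\<^sup>i)\<close>
  bijectively onto the set of these points, and it sends the join to the previous stage
  (\<open>\<Psi>_inj\<close>, \<open>\<Psi>_surj\<close>, \<open>\<Psi>_boundary\<close>).

  That \<open>Cone(i\<^sub>c)\<close> is injective, with image all \<open>t \<in> [-1,1]\<^sup>I\<close> such that \<open>{j. t\<^sub>j < 1} \<in> K\<^sub>I\<close>, is a
  layer-cake principle.  Substituting \<open>h = (1 - t)/2\<close>, it says that a function \<open>h\<close> with values in
  \<open>[0,1]\<close> is a sum of indicator functions of a chain of non-empty sets, with positive weights, in
  exactly one way.  Existence comes from the superlevel sets of \<open>h\<close>.  For uniqueness, the minimum of \<open>h\<close> on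
  \<open>T \<noteq> {}\<close> is the total weight of the sets containing \<open>T\<close>, and these totals determine the weights
  (\<open>chain_weights_exist\<close>, \<open>chain_weights_unique\<close>).

  The product \<open>C \<times> D\<^sup>i\<close> is star-shaped about the pair of apex and centre, with the join as its boundary;
  hence it is the cone on the join (\<open>toward_inj\<close>, \<open>toward_surj\<close>).  This turns the maps above into maps
  on cones.  Together with the inclusion of the previous stage they form a continuous surjection
  from a compact space to a Hausdorff one, which is a quotient map; as its fibres are the classes
  generated by the gluing, it induces the required homeomorphism (\<open>obtained_by_attaching_conesI\<close>).\<close>

section \<open>Maps out of quotients and cones\<close>

lemma equiv_gen_least:
  assumes "\<And>a b. \<lbrakk>(a, b) \<in> r; a \<in> S; b \<in> S\<rbrakk> \<Longrightarrow> g a = g b"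
    and "(a, b) \<in> equiv_gen S r"
  shows "g a = g b"
proof -
  have "(a, b) \<in> ((r \<union> r\<inverse>) \<inter> S \<times> S)\<^sup>*"
    using assms(2) by (simp add: equiv_gen_def)
  then show ?thesis
    by (induction rule: rtrancl_induct) (use assms(1) in \<open>force+\<close>)
qed

lemma equiv_gen_base: "\<lbrakk>(a, b) \<in> r; a \<in> S; b \<in> S\<rbrakk> \<Longrightarrow> (a, b) \<in> equiv_gen S r"
  by (auto simp: equiv_gen_def)

lemma quotient_class_eq_iff:
  assumes "a \<in> topspace X" "b \<in> topspace X"
  shows "quotient_class X r a = quotient_class X r b \<longleftrightarrow> (a, b) \<in> equiv_gen (topspace X) r"
  unfolding quotient_class_def using eq_equiv_class_iff[OF equiv_equiv_gen assms] .

lemma quotient_class_eqI: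
  "\<lbrakk>(a, b) \<in> r; a \<in> topspace X; b \<in> topspace X\<rbrakk> \<Longrightarrow> quotient_class X r a = quotient_class X r b"
  by (simp add: quotient_class_eq_iff equiv_gen_base)

lemma topspace_quotient_eq_image:
  "topspace (quotient_topology X r) = quotient_class X r ` topspace X"
  using quotient_imp_surjective_map[OF quotient_map_quotient_class, of X r] by simp

lemma quotient_topology_lift:
  assumes f: "continuous_map X Y f"
    and "\<And>a b. \<lbrakk>(a, b) \<in> r; a \<in> topspace X; b \<in> topspace X\<rbrakk> \<Longrightarrow> f a = f b"
  obtains g where "continuous_map (quotient_topology X r) Y g"
    "\<And>x. x \<in> topspace X \<Longrightarrow> g (quotient_class X r x) = f x"
proof (rule quotient_map_lift_exists[OF quotient_map_quotient_class f])
  show "f x = f y" if "x \<in> topspace X" "y \<in> topspace X" "quotient_class X r x = quotient_class X r y"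
    for x y
    using equiv_gen_least[of r "topspace X" f x y] assms(2) that by (simp add: quotient_class_eq_iff)
qed (use that in blast)

lemma compact_space_quotient_topology:
  assumes "compact_space X"
  shows "compact_space (quotient_topology X r)"
  using image_compactin[of X "topspace X" "quotient_topology X r" "quotient_class X r"] assms
    quotient_imp_continuous_map[OF quotient_map_quotient_class, of X r]
  by (simp add: compact_space_def topspace_quotient_eq_image)

text \<open>A quotient is determined up to homeomorphism by the partition of the total space into the
  fibres of the quotient map.\<close>

lemma homeomorphic_map_from_quotient_topology:
  assumes g: "quotient_map X Z g"
    and fibres: "\<And>a b. \<lbrakk>a \<in> topspace X; b \<in> topspace X\<rbrakk> \<Longrightarrow>
      g a = g b \<longleftrightarrow> (a, b) \<in> equiv_gen (topspace X) r"
  obtains h where "homeomorphic_map (quotient_topology X r) Z h"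
    "\<And>x. x \<in> topspace X \<Longrightarrow> h (quotient_class X r x) = g x"
proof -
  obtain h where h: "continuous_map (quotient_topology X r) Z h"
    and hg: "\<And>x. x \<in> topspace X \<Longrightarrow> h (quotient_class X r x) = g x"
    using quotient_topology_lift[OF quotient_imp_continuous_map[OF g], of r] fibres equiv_gen_base
    by metis
  have "quotient_map X Z (h \<circ> quotient_class X r)"
    by (rule quotient_map_eq[OF g]) (simp add: hg)
  then have "quotient_map (quotient_topology X r) Z h"
    using quotient_map_from_composition h quotient_imp_continuous_map[OF quotient_map_quotient_class]
    by blast
  moreover have "inj_on h (topspace (quotient_topology X r))"
    by (auto simp: topspace_quotient_eq_image inj_on_def hg fibres quotient_class_eq_iff)
  ultimately show ?thesis
    using that hg by (simp add: homeomorphic_map_def)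
qed

lemma topspace_cone_space:
  "topspace (cone_space A) = cone_class A ` (topspace A \<times> {0..1})"
  by (simp add: cone_space_def cone_class_def topspace_quotient_eq_image)

lemma compact_space_cone_space:
  assumes "compact_space A"
  shows "compact_space (cone_space A)"
proof -
  have "compact_space (top_of_set {0..1::real})"
    by (simp add: compact_space_subtopology)
  with assms show ?thesis
    unfolding cone_space_def by (intro compact_space_quotient_topology) (simp add: compact_space_prod_topology)
qed

lemma cone_class_apex:
  "\<lbrakk>a \<in> topspace A; b \<in> topspace A\<rbrakk> \<Longrightarrow> cone_class A (a, 1) = cone_class A (b, 1)"
  unfolding cone_class_def by (rule quotient_class_eqI) (auto simp: cone_rel_def)

lemma cone_space_lift:
  assumes "continuous_map (prod_topology A (top_of_set {0..1})) Y f"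
    and "\<And>a b. \<lbrakk>a \<in> topspace A; b \<in> topspace A\<rbrakk> \<Longrightarrow> f (a, 1) = f (b, 1)"
  obtains g where "continuous_map (cone_space A) Y g"
    "\<And>a s. \<lbrakk>a \<in> topspace A; s \<in> {0..1}\<rbrakk> \<Longrightarrow> g (cone_class A (a, s)) = f (a, s)"
proof -
  obtain g where "continuous_map (cone_space A) Y g"
    "\<And>p. p \<in> topspace (prod_topology A (top_of_set {0..1})) \<Longrightarrow> g (cone_class A p) = f p"
    unfolding cone_space_def cone_class_def
    by (rule quotient_topology_lift[OF assms(1), of "cone_rel A"]) (use assms(2) in \<open>auto simp: cone_rel_def\<close>)
  then show ?thesis by (intro that) auto
qed

section \<open>Disjoint unions\<close>

lemma continuous_map_Inl: "continuous_map X (coprod_topology X Y) Inl"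
proof -
  have "openin X {x \<in> topspace X. Inl x \<in> U}" if "openin X (Inl -` U)" for U
  proof -
    have "{x \<in> topspace X. Inl x \<in> U} = Inl -` U"
      using openin_subset[OF that] by auto
    with that show ?thesis by simp
  qed
  then show ?thesis
    by (auto simp: continuous_map_def openin_coprod_topology topspace_coprod_topology)
qed

lemma continuous_map_Inr: "continuous_map Y (coprod_topology X Y) Inr"
proof -
  have "openin Y {x \<in> topspace Y. Inr x \<in> U}" if "openin Y (Inr -` U)" for U
  proof -
    have "{x \<in> topspace Y. Inr x \<in> U} = Inr -` U"
      using openin_subset[OF that] by auto
    with that show ?thesis by simp
  qed
  then show ?thesis
    by (auto simp: continuous_map_def openin_coprod_topology topspace_coprod_topology)
qed

lemma compact_space_coprod_topology:
  assumes "compact_space X" "compact_space Y"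
  shows "compact_space (coprod_topology X Y)"
proof -
  have "topspace (coprod_topology X Y) = Inl ` topspace X \<union> Inr ` topspace Y"
    by (auto simp: topspace_coprod_topology)
  then show ?thesis
    using image_compactin[OF _ continuous_map_Inl] image_compactin[OF _ continuous_map_Inr] assms
    unfolding compact_space_def by (metis compactin_Un)
qed

lemma continuous_map_from_coprod:
  assumes "continuous_map X Z f" "continuous_map Y Z g"
  shows "continuous_map (coprod_topology X Y) Z (case_sum f g)"
proof -
  have "Inl -` {w \<in> topspace X <+> topspace Y. case_sum f g w \<in> U} = {x \<in> topspace X. f x \<in> U}"
    "Inr -` {w \<in> topspace X <+> topspace Y. case_sum f g w \<in> U} = {y \<in> topspace Y. g y \<in> U}" for U
    by auto
  then show ?thesis
    using assms
    by (auto simp: continuous_map_def openin_coprod_topology topspace_coprod_topology)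
qed

lemma compact_space_sum_topology:
  assumes "finite J" "\<And>j. j \<in> J \<Longrightarrow> compact_space (X j)"
  shows "compact_space (sum_topology X J)"
proof -
  have "topspace (sum_topology X J) = (\<Union>j\<in>J. Pair j ` topspace (X j))"
    by auto
  moreover have "compactin (sum_topology X J) (Pair j ` topspace (X j))" if "j \<in> J" for j
    using image_compactin[OF _ continuous_map_component_injection[OF that]] assms(2)[OF that]
    by (metis compact_space_def)
  ultimately show ?thesis
    using assms(1) by (auto simp: compact_space_def intro!: compactin_Union)
qed

lemma continuous_map_from_sum_topology:
  assumes "\<And>j. j \<in> J \<Longrightarrow> continuous_map (X j) Z (f j)"
  shows "continuous_map (sum_topology X J) Z (\<lambda>(j, x). f j x)"
proof -
  have "openin (X j) {x \<in> topspace (X j). f j x \<in> U}" if "j \<in> J" "openin Z U" for j U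
    using assms that by (auto simp: continuous_map_def)
  moreover have "{x. (j, x) \<in> Sigma J (topspace \<circ> X) \<and> f j x \<in> U} = {x \<in> topspace (X j). f j x \<in> U}"
    if "j \<in> J" for j U
    using that by auto
  ultimately show ?thesis
    using assms by (fastforce simp: continuous_map_def openin_sum_topology)
qed

section \<open>Recognizing an attachment of cones\<close>

text \<open>The disjoint union of \<open>X\<close> and the cones is compact and \<open>Z\<close> is Hausdorff, so the map between
  them assembled from the inclusion of \<open>X\<close> and the \<open>F j\<close> is automatically a quotient map.  Only its
  fibres matter then: a point of a cone off the base has a unique preimage, and a base point
  \<open>(a, 0)\<close> is identified with \<open>f j a\<close> and with nothing else.\<close>

lemma obtained_by_attaching_conesI:
  fixes F :: "'j \<Rightarrow> 'a \<times> real \<Rightarrow> 'x"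
  assumes "finite J" and X: "compact_space X" and Z: "Hausdorff_space Z"
    and A: "\<And>j. j \<in> J \<Longrightarrow> compact_space (A j)"
    and XZ: "continuous_map X Z (\<lambda>x. x)"
    and f: "\<And>j. j \<in> J \<Longrightarrow> continuous_map (A j) X (f j)"
    and F: "\<And>j. j \<in> J \<Longrightarrow> continuous_map (prod_topology (A j) (top_of_set {0..1})) Z (F j)"
    and base: "\<And>j a. \<lbrakk>j \<in> J; a \<in> topspace (A j)\<rbrakk> \<Longrightarrow> F j (a, 0) = f j a"
    and apex: "\<And>j a b. \<lbrakk>j \<in> J; a \<in> topspace (A j); b \<in> topspace (A j)\<rbrakk> \<Longrightarrow> F j (a, 1) = F j (b, 1)"
    and surj: "topspace Z \<subseteq> topspace X \<union> (\<Union>j\<in>J. F j ` (topspace (A j) \<times> {0..1}))"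
    and off_X: "\<And>j a s. \<lbrakk>j \<in> J; a \<in> topspace (A j); 0 < s; s \<le> 1\<rbrakk> \<Longrightarrow> F j (a, s) \<notin> topspace X"
    and inj: "\<And>j k a b s t. \<lbrakk>j \<in> J; k \<in> J; a \<in> topspace (A j); b \<in> topspace (A k);
        0 < s; s \<le> 1; 0 < t; t \<le> 1; F j (a, s) = F k (b, t)\<rbrakk> \<Longrightarrow> j = k \<and> s = t \<and> (a = b \<or> s = 1)"
  shows "obtained_by_attaching_cones Z X J A f"
proof -
  let ?W = "attach_sum X J A" and ?R = "attach_rel J A f"
  have "\<forall>j\<in>J. \<exists>g. continuous_map (cone_space (A j)) Z g \<and>
      (\<forall>a\<in>topspace (A j). \<forall>s\<in>{0..1}. g (cone_class (A j) (a, s)) = F j (a, s))"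
    by (metis (no_types, lifting) cone_space_lift[OF F apex])
  then obtain G where G: "\<And>j. j \<in> J \<Longrightarrow> continuous_map (cone_space (A j)) Z (G j)"
    and GF: "\<And>j a s. \<lbrakk>j \<in> J; a \<in> topspace (A j); s \<in> {0..1}\<rbrakk> \<Longrightarrow> G j (cone_class (A j) (a, s)) = F j (a, s)"
    by metis
  define g where "g = case_sum (\<lambda>x. x) (\<lambda>(j, c). G j c)"
  have g_Inl [simp]: "g (Inl x) = x" and g_Inr [simp]: "g (Inr (j, c)) = G j c" for x j c
    by (simp_all add: g_def)
  have cont: "continuous_map ?W Z g"
    unfolding g_def attach_sum_def by (intro continuous_map_from_coprod continuous_map_from_sum_topology XZ G)
  have compact: "compact_space ?W"
    unfolding attach_sum_def
    by (intro compact_space_coprod_topology compact_space_sum_topology X assms(1) compact_space_cone_space A)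
  have W: "topspace ?W = Inl ` topspace X \<union>
      (\<Union>j\<in>J. \<Union>a\<in>topspace (A j). \<Union>s\<in>{0..1}. {Inr (j, cone_class (A j) (a, s))})"
    by (fastforce simp: attach_sum_def topspace_coprod_topology topspace_cone_space)
  have W_Inr: "Inr (j, cone_class (A j) (a, s)) \<in> topspace ?W"
    if "j \<in> J" "a \<in> topspace (A j)" "s \<in> {0..1}" for j a s
    using that unfolding W by blast
  have "topspace Z \<subseteq> g ` topspace ?W"
  proof
    fix z assume "z \<in> topspace Z"
    with surj consider "z \<in> topspace X"
      | j a s where "j \<in> J" "a \<in> topspace (A j)" "s \<in> {0..1}" "z = F j (a, s)"
      by auto
    then show "z \<in> g ` topspace ?W"
    proof cases
      case 1
      then show ?thesis by (intro image_eqI[of _ _ "Inl z"]) (auto simp: W)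
    next
      case 2
      then show ?thesis by (intro image_eqI[of _ _ "Inr (j, cone_class (A j) (a, s))"] W_Inr) (simp_all add: GF)
    qed
  qed
  then have quot: "quotient_map ?W Z g"
    using cont continuous_map_image_subset_topspace[OF cont]
    by (intro continuous_closed_imp_quotient_map continuous_imp_closed_map compact Z) auto
  have rel: "(w, w') \<in> equiv_gen (topspace ?W) ?R" if "w \<in> topspace ?W" "w' \<in> topspace ?W" "g w = g w'" for w w'
  proof -
    let ?E = "equiv_gen (topspace ?W) ?R"
    have trans: "trans ?E" and sym: "sym ?E" and refl: "\<And>v. v \<in> topspace ?W \<Longrightarrow> (v, v) \<in> ?E"
      using equiv_equiv_gen[of "topspace ?W" ?R] by (auto simp: equiv_def refl_on_def)
    \<comment> \<open>Up to equivalence, every point lies either in \<open>X\<close> or strictly above the base of a cone.\<close>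
    define nf where "nf v \<longleftrightarrow> (\<exists>x\<in>topspace X. v = Inl x) \<or>
      (\<exists>j\<in>J. \<exists>a\<in>topspace (A j). \<exists>s. 0 < s \<and> s \<le> 1 \<and> v = Inr (j, cone_class (A j) (a, s)))" for v
    have normalize: "\<exists>v'. nf v' \<and> (v, v') \<in> ?E \<and> g v = g v'" if v: "v \<in> topspace ?W" for v
    proof (cases "nf v")
      case True
      with refl v show ?thesis by blast
    next
      case False
      then obtain j a where j: "j \<in> J" "a \<in> topspace (A j)" and veq: "v = Inr (j, cone_class (A j) (a, 0))"
        using v unfolding W nf_def by (auto simp: order_less_le) blast
      have fa: "f j a \<in> topspace X"
        using continuous_map_image_subset_topspace[OF f[OF j(1)]] j(2) by blast
      have "(v, Inl (f j a)) \<in> ?R"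
        using j unfolding veq attach_rel_def by blast
      with fa v have "(v, Inl (f j a)) \<in> ?E"
        by (intro equiv_gen_base) (auto simp: W)
      with fa j show ?thesis
        by (intro exI[of _ "Inl (f j a)"]) (auto simp: nf_def veq GF base)
    qed
    have nf_inj: "v = v'" if "nf v" "nf v'" "g v = g v'" for v v'
    proof -
      consider x x' where "x \<in> topspace X" "v = Inl x" "x' \<in> topspace X" "v' = Inl x'"
        | x k b t where "x \<in> topspace X" "v = Inl x"
            "k \<in> J" "b \<in> topspace (A k)" "0 < t" "t \<le> 1" "v' = Inr (k, cone_class (A k) (b, t))"
        | j a s x' where "j \<in> J" "a \<in> topspace (A j)" "0 < s" "s \<le> 1" "v = Inr (j, cone_class (A j) (a, s))"
            "x' \<in> topspace X" "v' = Inl x'"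
        | j a s k b t where "j \<in> J" "a \<in> topspace (A j)" "0 < s" "s \<le> 1" "v = Inr (j, cone_class (A j) (a, s))"
            "k \<in> J" "b \<in> topspace (A k)" "0 < t" "t \<le> 1" "v' = Inr (k, cone_class (A k) (b, t))"
        using \<open>nf v\<close> \<open>nf v'\<close> unfolding nf_def by metis
      then show ?thesis
      proof cases
        case 1
        with \<open>g v = g v'\<close> show ?thesis by simp
      next
        case 2
        with \<open>g v = g v'\<close> off_X[of k b t] show ?thesis by (simp add: GF)
      next
        case 3
        with \<open>g v = g v'\<close> off_X[of j a s] show ?thesis by (simp add: GF)
      next
        case 4
        with \<open>g v = g v'\<close> have "F j (a, s) = F k (b, t)" by (simp add: GF)
        with 4 inj[of j k a b s t] have "j = k" "s = t" "a = b \<or> s = 1" by blast+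
        with 4 cone_class_apex[of a "A j" b] show ?thesis by auto
      qed
    qed
    obtain v v' where v: "nf v" "(w, v) \<in> ?E" "g w = g v" "nf v'" "(w', v') \<in> ?E" "g w' = g v'"
      using normalize \<open>w \<in> topspace ?W\<close> \<open>w' \<in> topspace ?W\<close> by metis
    then have "v = v'" using nf_inj \<open>g w = g w'\<close> by metis
    with v show ?thesis using trans sym by (meson symE transE)
  qed
  have fibres: "g w = g w' \<longleftrightarrow> (w, w') \<in> equiv_gen (topspace ?W) ?R"
    if "w \<in> topspace ?W" "w' \<in> topspace ?W" for w w'
  proof
    assume "(w, w') \<in> equiv_gen (topspace ?W) ?R"
    then show "g w = g w'"
      by (rule equiv_gen_least[rotated]) (auto simp: attach_rel_def GF base)
  qed (use rel that in blast)
  obtain h where "homeomorphic_map (quotient_topology ?W ?R) Z h"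
    "\<And>w. w \<in> topspace ?W \<Longrightarrow> h (quotient_class ?W ?R w) = g w"
    using homeomorphic_map_from_quotient_topology[OF quot fibres] by blast
  then show ?thesis
    unfolding obtained_by_attaching_cones_def using f by (intro conjI exI[of _ h] ballI) (auto simp: W)
qed

section \<open>The disc as a reduced cone\<close>

text \<open>Both sides of the equation lie on one ray from \<open>1\<close> (translated to the origin), and such a ray
  meets the unit circle in at most one further point; so the chords agree, and then the factors do.\<close>

lemma chord_from_one_unique:
  assumes "x \<in> sphere 0 1" "x' \<in> sphere 0 1" and eq: "of_real a * (x - 1) = of_real b * (x' - 1)"
    and "0 < a" "0 < b" "x \<noteq> (1::complex)"
  shows "a = b \<and> x = x'"
proof -
  have norm: "(Re x)\<^sup>2 + (Im x)\<^sup>2 = 1" "(Re x')\<^sup>2 + (Im x')\<^sup>2 = 1"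
    using assms(1,2) by (simp_all add: dist_norm cmod_def)
  have Re: "a * (Re x - 1) = b * (Re x' - 1)" and Im: "a * Im x = b * Im x'"
    using arg_cong[OF eq, of Re] arg_cong[OF eq, of Im] by simp_all
  have "Re x \<noteq> 1"
    using norm(1) \<open>x \<noteq> 1\<close> by (auto simp: complex_eq_iff)
  have "b\<^sup>2 = (b * Re x')\<^sup>2 + (b * Im x')\<^sup>2"
    using norm(2) by (simp add: power_mult_distrib flip: distrib_left)
  also have "b * Re x' = b + a * (Re x - 1)"
    using Re by (simp add: algebra_simps)
  also have "(b + a * (Re x - 1))\<^sup>2 + (b * Im x')\<^sup>2
      = b\<^sup>2 + 2 * a * (Re x - 1) * (b - a) + a\<^sup>2 * ((Re x)\<^sup>2 + (Im x)\<^sup>2 - 1)"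
    unfolding Im[symmetric] by (simp add: power2_eq_square algebra_simps)
  finally have "a * (Re x - 1) * (b - a) = 0"
    using norm(1) by simp
  with \<open>Re x \<noteq> 1\<close> \<open>0 < a\<close> have "a = b" by simp
  with eq \<open>0 < a\<close> show ?thesis by simp
qed

lemma fraction_of_chord_eq_iff:
  assumes "x \<in> sphere 0 1" "t \<in> {-1..1}" "x' \<in> sphere 0 1" "t' \<in> {-1..1}"
  shows "of_real (1 + t) * (x - 1) = (of_real (1 + t') * (x' - 1) :: complex) \<longleftrightarrow>
    t = t' \<and> x = x' \<or> (t = -1 \<or> x = 1) \<and> (t' = -1 \<or> x' = 1)" (is "?eq \<longleftrightarrow> ?R")
proof
  have zero: "of_real (1 + s) = (0::complex) \<longleftrightarrow> s = -1" for s
    by (metis add_eq_0_iff of_real_eq_0_iff add.inverse_inverse)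
  show ?R if ?eq
  proof (cases "t = -1 \<or> x = 1 \<or> t' = -1 \<or> x' = 1")
    case True
    with zero that show ?thesis by (metis mult_eq_0_iff right_minus_eq)
  next
    case False
    then show ?thesis
      using chord_from_one_unique[OF assms(1,3) that] assms by auto
  qed
  show ?eq if ?R
    using that zero by auto
qed

lemma topspace_S1_cyl: "topspace S1_cyl = sphere 0 1 \<times> {-1..1}"
  by (simp add: S1_cyl_def)

lemma quotient_map_D2_pt: "quotient_map S1_cyl D2 (\<lambda>(x, t). D2_pt t x)"
  using quotient_map_quotient_class[of S1_cyl D2_rel] by (simp add: D2_def D2_pt_def case_prod_beta')

lemma topspace_D2: "topspace D2 = (\<lambda>(x, t). D2_pt t x) ` (sphere 0 1 \<times> {-1..1})"
  using quotient_imp_surjective_map[OF quotient_map_D2_pt] by (simp add: topspace_S1_cyl)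

lemma D2_pt_in_D2: "\<lbrakk>x \<in> sphere 0 1; t \<in> {-1..1}\<rbrakk> \<Longrightarrow> D2_pt t x \<in> topspace D2"
  by (force simp: topspace_D2)

lemma continuous_map_D2_pt:
  assumes "continuous_map X S1 f" "continuous_map X (top_of_set {-1..1}) g"
  shows "continuous_map X D2 (\<lambda>p. D2_pt (g p) (f p))"
proof -
  have "continuous_map X S1_cyl (\<lambda>p. (f p, g p))"
    unfolding S1_cyl_def by (rule continuous_map_pairedI[OF assms])
  from continuous_map_compose[OF this quotient_imp_continuous_map[OF quotient_map_D2_pt]]
  show ?thesis by (simp add: o_def)
qed

lemma D2_pt_collapsed:
  assumes "x \<in> sphere 0 1" "t \<in> {-1..1}" "t = -1 \<or> x = 1"
  shows "D2_pt t x = D2_base"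
  unfolding D2_base_def D2_pt_def
  by (rule quotient_class_eqI) (use assms in \<open>auto simp: D2_rel_def Let_def topspace_S1_cyl\<close>)

text \<open>The reduced cone on the circle is a planar disc: sending \<open>(t, x)\<close> to the point at the
  fraction \<open>1 + t\<close> of the chord from \<open>1\<close> to \<open>x\<close> collapses exactly what the reduced cone
  collapses.  This one invariant shows that \<^const>\<open>D2\<close> is Hausdorff and decides when two
  symbols \<open>(t, x)\<close> denote the same point.\<close>

lemma D2_chart:
  obtains e :: "(complex \<times> real) set \<Rightarrow> complex" where "continuous_map D2 euclidean e"
    "\<And>x t. \<lbrakk>x \<in> sphere 0 1; t \<in> {-1..1}\<rbrakk> \<Longrightarrow> e (D2_pt t x) = of_real (1 + t) * (x - 1)"
proof -
  let ?e = "\<lambda>(x, t). of_real (1 + t) * (x - 1) :: complex"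
  have "S1_cyl = top_of_set (sphere 0 1 \<times> {-1..1})"
    by (simp add: S1_cyl_def subtopology_Times)
  moreover have "continuous_on (sphere 0 1 \<times> {-1..1}) ?e"
    unfolding case_prod_beta' by (intro continuous_intros)
  ultimately have cont: "continuous_map S1_cyl euclidean ?e"
    by (metis continuous_map_iff_continuous)
  obtain e where "continuous_map D2 euclidean e"
    "\<And>p. p \<in> topspace S1_cyl \<Longrightarrow> e (quotient_class S1_cyl D2_rel p) = ?e p"
    unfolding D2_def by (rule quotient_topology_lift[OF cont, of D2_rel]) (auto simp: D2_rel_def Let_def)
  then show ?thesis
    by (intro that[of e]) (auto simp: D2_pt_def topspace_S1_cyl)
qed

lemma D2_pt_eq_iff:
  assumes "x \<in> sphere 0 1" "t \<in> {-1..1}" "x' \<in> sphere 0 1" "t' \<in> {-1..1}"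
  shows "D2_pt t x = D2_pt t' x' \<longleftrightarrow> t = t' \<and> x = x' \<or> (t = -1 \<or> x = 1) \<and> (t' = -1 \<or> x' = 1)"
proof
  obtain e :: "(complex \<times> real) set \<Rightarrow> complex" where
    e: "\<And>x t. \<lbrakk>x \<in> sphere 0 1; t \<in> {-1..1}\<rbrakk> \<Longrightarrow> e (D2_pt t x) = of_real (1 + t) * (x - 1)"
    using D2_chart by metis
  assume "D2_pt t x = D2_pt t' x'"
  then have "e (D2_pt t x) = e (D2_pt t' x')" by simp
  then show "t = t' \<and> x = x' \<or> (t = -1 \<or> x = 1) \<and> (t' = -1 \<or> x' = 1)"
    unfolding e[OF assms(1,2)] e[OF assms(3,4)] fraction_of_chord_eq_iff[OF assms] .
next
  assume "t = t' \<and> x = x' \<or> (t = -1 \<or> x = 1) \<and> (t' = -1 \<or> x' = 1)"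
  then show "D2_pt t x = D2_pt t' x'"
    using D2_pt_collapsed[OF assms(1,2)] D2_pt_collapsed[OF assms(3,4)] by auto
qed

lemma D2_pt_eq_base_iff:
  "\<lbrakk>x \<in> sphere 0 1; t \<in> {-1..1}\<rbrakk> \<Longrightarrow> D2_pt t x = D2_base \<longleftrightarrow> t = -1 \<or> x = 1"
  unfolding D2_base_def using D2_pt_eq_iff[of x t 1 "-1"] by auto

lemma Hausdorff_D2: "Hausdorff_space D2"
proof -
  obtain e :: "(complex \<times> real) set \<Rightarrow> complex" where e: "continuous_map D2 euclidean e"
    "\<And>x t. \<lbrakk>x \<in> sphere 0 1; t \<in> {-1..1}\<rbrakk> \<Longrightarrow> e (D2_pt t x) = of_real (1 + t) * (x - 1)"
    using D2_chart by metis
  have "inj_on e (topspace D2)"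
  proof (rule inj_onI)
    fix p p' assume "p \<in> topspace D2" "p' \<in> topspace D2" and eq: "e p = e p'"
    then obtain x t x' t' where p: "x \<in> sphere 0 1" "t \<in> {-1..1}" "p = D2_pt t x"
      and p': "x' \<in> sphere 0 1" "t' \<in> {-1..1}" "p' = D2_pt t' x'"
      unfolding topspace_D2 by auto
    from eq have "of_real (1 + t) * (x - 1) = (of_real (1 + t') * (x' - 1) :: complex)"
      unfolding p(3) p'(3) e(2)[OF p(1,2)] e(2)[OF p'(1,2)] .
    then show "p = p'"
      unfolding p(3) p'(3) fraction_of_chord_eq_iff[OF p(1,2) p'(1,2)] D2_pt_eq_iff[OF p(1,2) p'(1,2)] .
  qed
  with Hausdorff_space_euclidean e(1) show ?thesis
    by (rule Hausdorff_space_injective_preimage)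
qed

lemma compact_D2: "compact_space D2"
proof -
  have "compact_space S1_cyl"
    unfolding S1_cyl_def compact_space_prod_topology by (simp add: compact_space_subtopology)
  then show ?thesis
    unfolding D2_def by (rule compact_space_quotient_topology)
qed

lemma D2_base_in_D2: "D2_base \<in> topspace D2"
  unfolding D2_base_def by (rule D2_pt_in_D2) auto

lemma D2_circle_subset: "D2_circle \<subseteq> topspace D2"
  by (auto simp: D2_circle_def intro: D2_pt_in_D2)

lemma D2_base_in_circle: "D2_base \<in> D2_circle"
  unfolding D2_circle_def by (rule image_eqI[of _ _ 1]) (use D2_pt_collapsed[of 1 1] in auto)

lemma D2_pt_in_circle_iff:
  assumes "x \<in> sphere 0 1" "t \<in> {-1..1}"
  shows "D2_pt t x \<in> D2_circle \<longleftrightarrow> t = 1 \<or> D2_pt t x = D2_base"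
proof
  assume "D2_pt t x \<in> D2_circle"
  then obtain x' where "x' \<in> sphere 0 1" "D2_pt t x = D2_pt 1 x'"
    by (auto simp: D2_circle_def)
  then show "t = 1 \<or> D2_pt t x = D2_base"
    using D2_pt_eq_iff[OF assms, of x' 1] D2_pt_eq_base_iff[OF assms] by auto
next
  assume "t = 1 \<or> D2_pt t x = D2_base"
  with assms show "D2_pt t x \<in> D2_circle"
    using D2_base_in_circle by (auto simp: D2_circle_def)
qed

lemma compactin_D2_circle: "compactin D2 D2_circle"
proof -
  have "continuous_map S1 D2 (D2_pt 1)"
    using continuous_map_D2_pt[of S1 "\<lambda>x. x" "\<lambda>_. 1"] by (simp add: continuous_map_const)
  moreover have "compactin S1 (sphere 0 1)"
    by (simp add: compactin_subtopology)
  ultimately show ?thesis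
    unfolding D2_circle_def by (rule image_compactin[rotated])
qed

section \<open>Weighted chains of sets and their heights\<close>

definition height :: "'v set \<Rightarrow> ('v set \<Rightarrow> real) \<Rightarrow> 'v \<Rightarrow> real" where
  "height I c j = (\<Sum>\<sigma> | \<sigma> \<subseteq> I \<and> j \<in> \<sigma>. c \<sigma>)"

text \<open>Up to normalization, these are the barycentric coordinates of a point of a barycentric
  subdivision.  The empty set may carry weight: it adds to no height, and it will stand for the cone
  point.\<close>

definition chain_weights :: "'v set \<Rightarrow> ('v set \<Rightarrow> real) \<Rightarrow> bool" where
  "chain_weights I c \<longleftrightarrow> (\<forall>\<sigma>. 0 \<le> c \<sigma>) \<and> (\<forall>\<sigma> \<tau>. c \<sigma> \<noteq> 0 \<longrightarrow> c \<tau> \<noteq> 0 \<longrightarrow> \<sigma> \<subseteq> \<tau> \<or> \<tau> \<subseteq> \<sigma>) \<and>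
     (\<forall>\<sigma>. c \<sigma> \<noteq> 0 \<longrightarrow> \<sigma> \<subseteq> I)"

text \<open>Among the elements of \<open>T\<close> there is one that lies in no member of the chain except those
  that contain all of \<open>T\<close>: take it outside the largest member that does not contain \<open>T\<close>.\<close>

lemma chain_weights_sum_supersets:
  assumes "finite I" "chain_weights I c" "T \<subseteq> I" "T \<noteq> {}"
  shows "(\<Sum>\<sigma> | \<sigma> \<subseteq> I \<and> T \<subseteq> \<sigma>. c \<sigma>) = Min (height I c ` T)"
proof -
  have nonneg: "0 \<le> c \<sigma>" for \<sigma>
    using assms(2) by (simp add: chain_weights_def)
  have chain: "\<sigma> \<subseteq> \<tau> \<or> \<tau> \<subseteq> \<sigma>" if "c \<sigma> \<noteq> 0" "c \<tau> \<noteq> 0" for \<sigma> \<tau>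
    using assms(2) that by (simp add: chain_weights_def)
  have fin: "finite {\<sigma>. \<sigma> \<subseteq> I \<and> P \<sigma>}" for P
    using assms(1) by simp
  have ge: "(\<Sum>\<sigma> | \<sigma> \<subseteq> I \<and> T \<subseteq> \<sigma>. c \<sigma>) \<le> height I c l" if "l \<in> T" for l
    unfolding height_def using that by (intro sum_mono2 fin) (auto simp: nonneg)
  define S where "S = {\<sigma>. \<sigma> \<subseteq> I \<and> c \<sigma> \<noteq> 0 \<and> \<not> T \<subseteq> \<sigma>}"
  have "\<exists>j\<in>T. \<forall>\<sigma>\<in>S. j \<notin> \<sigma>"
  proof (cases "S = {}")
    case False
    have "finite S" unfolding S_def by (rule fin)
    with False obtain \<rho> where \<rho>: "\<rho> \<in> S" "\<And>\<sigma>. \<lbrakk>\<sigma> \<in> S; \<rho> \<subseteq> \<sigma>\<rbrakk> \<Longrightarrow> \<sigma> = \<rho>"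
      using finite_has_maximal[of S] by metis
    from \<rho>(1) have "\<not> T \<subseteq> \<rho>" by (simp add: S_def)
    then obtain j where j: "j \<in> T" "j \<notin> \<rho>" by blast
    moreover have "\<sigma> \<subseteq> \<rho>" if "\<sigma> \<in> S" for \<sigma>
    proof -
      have "\<sigma> \<subseteq> \<rho> \<or> \<rho> \<subseteq> \<sigma>"
        using that \<rho>(1) by (intro chain) (simp_all add: S_def)
      with \<rho>(2)[OF that] show ?thesis by blast
    qed
    ultimately show ?thesis by blast
  qed (use assms(4) in blast)
  then obtain j where "j \<in> T" and j: "\<And>\<sigma>. \<lbrakk>\<sigma> \<subseteq> I; c \<sigma> \<noteq> 0; j \<in> \<sigma>\<rbrakk> \<Longrightarrow> T \<subseteq> \<sigma>"
    by (auto simp: S_def)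
  have "(\<Sum>\<sigma> | \<sigma> \<subseteq> I \<and> T \<subseteq> \<sigma>. c \<sigma>) = height I c j"
    unfolding height_def by (rule sum.mono_neutral_left[OF fin]) (use j \<open>j \<in> T\<close> in auto)
  moreover have "finite T" using assms(1,3) finite_subset by blast
  ultimately show ?thesis
    using ge \<open>j \<in> T\<close> by (intro Min_eqI[symmetric]) (auto intro: rev_image_eqI)
qed

text \<open>The heights determine the sums of the weights over all supersets of a given set, and from
  these the weights themselves are recovered from the largest sets downwards.\<close>

lemma chain_weights_unique:
  assumes "finite I" "chain_weights I c" "chain_weights I c'"
    and eq: "\<And>j. j \<in> I \<Longrightarrow> height I c j = height I c' j"
    and "\<sigma> \<subseteq> I" "\<sigma> \<noteq> {}"
  shows "c \<sigma> = c' \<sigma>"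
  using \<open>\<sigma> \<subseteq> I\<close> \<open>\<sigma> \<noteq> {}\<close>
proof (induction "card (I - \<sigma>)" arbitrary: \<sigma> rule: less_induct)
  case less
  let ?A = "{\<tau>. \<tau> \<subseteq> I \<and> \<sigma> \<subseteq> \<tau>}"
  have "finite ?A" "\<sigma> \<in> ?A" using assms(1) less.prems by auto
  moreover have "height I c ` \<sigma> = height I c' ` \<sigma>"
    using less.prems eq by (intro image_cong) auto
  then have "sum c ?A = sum c' ?A"
    using chain_weights_sum_supersets assms(1-3) less.prems by metis
  moreover have "sum c (?A - {\<sigma>}) = sum c' (?A - {\<sigma>})"
  proof (rule sum.cong)
    fix \<tau> assume "\<tau> \<in> ?A - {\<sigma>}"
    moreover from this have "card (I - \<tau>) < card (I - \<sigma>)"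
      using assms(1) by (intro psubset_card_mono) auto
    ultimately show "c \<tau> = c' \<tau>"
      using less.hyps[of \<tau>] less.prems by auto
  qed simp
  ultimately show ?case
    using sum.remove[of ?A \<sigma> c] sum.remove[of ?A \<sigma> c'] by simp
qed

text \<open>Layer-cake decomposition: the weight of \<open>\<sigma>\<close> is the total length of the levels
  \<open>r \<in> (0, 1]\<close> at which \<open>\<sigma>\<close> is the superlevel set of \<open>h\<close>.  Superlevel sets are nested.\<close>

lemma chain_weights_exist:
  assumes "finite I" and h: "\<forall>j\<in>I. 0 \<le> h j \<and> h j \<le> 1"
  shows "\<exists>c. chain_weights I c \<and> (\<forall>j\<in>I. height I c j = h j) \<and>
    (\<forall>\<sigma>. c \<sigma> \<noteq> 0 \<longrightarrow> \<sigma> \<subseteq> {j \<in> I. 0 < h j}) \<and> sum c (Pow I) = 1"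
proof -
  define lev where "lev r = {j \<in> I. r \<le> h j}" for r
  define c where "c \<sigma> = measure lborel {r \<in> {0<..1}. lev r = \<sigma>}" for \<sigma>
  have meas: "{r \<in> {0<..1}. lev r = \<sigma>} \<in> sets lborel" if "\<sigma> \<subseteq> I" for \<sigma>
  proof -
    have "{r \<in> {0<..1}. lev r = \<sigma>} = {r. 0 < r \<and> r \<le> 1 \<and> (\<forall>j\<in>I. r \<le> h j \<longleftrightarrow> j \<in> \<sigma>)}"
      using that by (auto simp: lev_def)
    also have "\<dots> \<in> sets borel" using assms(1) by measurable
    finally show ?thesis by simp
  qed
  have sum_c: "sum c T = measure lborel {r \<in> {0<..1}. lev r \<in> T}" if "T \<subseteq> Pow I" for T
  proof -
    have "finite T" using that assms(1) finite_subset by blast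
    have finite_measure: "emeasure lborel {r \<in> {0<..1}. lev r = \<sigma>} \<noteq> \<infinity>" for \<sigma>
    proof -
      have "bounded {r \<in> {0<..1}. lev r = \<sigma>}"
        by (rule bounded_subset[of "{0..1}"]) auto
      from emeasure_bounded_finite[OF this] show ?thesis by (metis less_irrefl)
    qed
    have "\<And>\<sigma>. \<sigma> \<in> T \<Longrightarrow> {r \<in> {0<..1}. lev r = \<sigma>} \<in> sets lborel"
      using that meas by blast
    then have "measure lborel (\<Union>\<sigma>\<in>T. {r \<in> {0<..1}. lev r = \<sigma>})
        = (\<Sum>\<sigma>\<in>T. measure lborel {r \<in> {0<..1}. lev r = \<sigma>})"
      by (intro measure_finite_Union[OF \<open>finite T\<close> _ _ finite_measure])
        (auto simp: disjoint_family_on_def)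
    then have "measure lborel (\<Union>\<sigma>\<in>T. {r \<in> {0<..1}. lev r = \<sigma>}) = sum c T"
      by (simp add: c_def[abs_def])
    moreover have "(\<Union>\<sigma>\<in>T. {r \<in> {0<..1}. lev r = \<sigma>}) = {r \<in> {0<..1}. lev r \<in> T}" by auto
    ultimately show ?thesis by simp
  qed
  have nonzero: "\<exists>r. 0 < r \<and> r \<le> 1 \<and> lev r = \<sigma>" if "c \<sigma> \<noteq> 0" for \<sigma>
  proof (rule ccontr)
    assume "\<nexists>r. 0 < r \<and> r \<le> 1 \<and> lev r = \<sigma>"
    then have "{r \<in> {0<..1}. lev r = \<sigma>} = {}" by auto
    with that show False unfolding c_def by (metis measure_empty)
  qed
  have "chain_weights I c"
    unfolding chain_weights_def
  proof (intro conjI allI impI)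
    show "0 \<le> c \<sigma>" for \<sigma> by (simp add: c_def)
    fix \<sigma> assume "c \<sigma> \<noteq> 0"
    then obtain r where r: "lev r = \<sigma>" using nonzero by blast
    then show "\<sigma> \<subseteq> I" by (auto simp: lev_def)
    fix \<tau> assume "c \<tau> \<noteq> 0"
    then obtain r' where r': "lev r' = \<tau>" using nonzero by blast
    show "\<sigma> \<subseteq> \<tau> \<or> \<tau> \<subseteq> \<sigma>"
      using linear[of r r'] by (auto simp: lev_def simp flip: r r')
  qed
  moreover have "height I c j = h j" if "j \<in> I" for j
  proof -
    have "height I c j = measure lborel {r \<in> {0<..1}. lev r \<in> {\<sigma>. \<sigma> \<subseteq> I \<and> j \<in> \<sigma>}}"
      unfolding height_def by (rule sum_c) auto
    also have "{r \<in> {0<..1}. lev r \<in> {\<sigma>. \<sigma> \<subseteq> I \<and> j \<in> \<sigma>}} = {0<..h j}"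
      using bspec[OF h that] that by (auto simp: lev_def)
    finally show ?thesis using bspec[OF h that] by simp
  qed
  moreover have "\<sigma> \<subseteq> {j \<in> I. 0 < h j}" if "c \<sigma> \<noteq> 0" for \<sigma>
    using nonzero[OF that] by (force simp: lev_def)
  moreover have "sum c (Pow I) = 1"
  proof -
    have "{r \<in> {0<..1}. lev r \<in> Pow I} = {0<..1::real}" by (auto simp: lev_def)
    then show ?thesis by (simp add: sum_c)
  qed
  ultimately show ?thesis by (intro exI[of _ c] conjI ballI allI impI)
qed

section \<open>The cone on a simplicial complex and the disc\<close>

lemma support_in_simplicial_cone_iff:
  "{v. y v \<noteq> 0} \<in> simplicial_cone L \<longleftrightarrow> {v. y (Some v) \<noteq> 0} \<in> L"
proof (cases "y None = 0")
  case True
  then have "{v. y v \<noteq> 0} = Some ` {v. y (Some v) \<noteq> 0}"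
    by (auto simp: image_iff) (metis option.exhaust)
  then show ?thesis
    by (auto simp: simplicial_cone_def cone_base_def inj_image_eq_iff)
next
  case False
  let ?B = "insert None (Some ` {v. y (Some v) \<noteq> 0})"
  have "{v. y v \<noteq> 0} = ?B"
    using False by (auto simp: image_iff) (metis option.exhaust)
  moreover have iff: "?B = insert None (Some ` \<sigma>) \<longleftrightarrow> {v. y (Some v) \<noteq> 0} = \<sigma>" for \<sigma>
    by (metis (no_types, lifting) Diff_insert_absorb image_iff inj_Some inj_image_eq_iff option.distinct(1))
  moreover have "?B \<in> simplicial_cone L \<longleftrightarrow> (\<exists>\<sigma>\<in>L. ?B = insert None (Some ` \<sigma>))"
  proof -
    have "?B \<notin> cone_base L"
      unfolding cone_base_def by (rule notI, erule imageE) (metis imageE insertI1 option.distinct(1))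
    then show ?thesis
      unfolding simplicial_cone_def Un_iff by (simp only: cone_base_def image_image) (simp only: image_iff simp_thms)
  qed
  ultimately show ?thesis by (simp only: bex_simps) blast
qed

lemma support_in_cone_base_iff:
  "{v. y v \<noteq> 0} \<in> cone_base L \<longleftrightarrow> y None = 0 \<and> {v. y (Some v) \<noteq> 0} \<in> L"
proof (cases "y None = 0")
  case True
  then have "{v. y v \<noteq> 0} = Some ` {v. y (Some v) \<noteq> 0}"
    by (auto simp: image_iff) (metis option.exhaust)
  with True show ?thesis
    by (auto simp: cone_base_def inj_image_eq_iff)
qed (auto simp: cone_base_def)

text \<open>The support varies with the point, but a sum over a fixed finite vertex set is visibly linear
  and continuous in the point.\<close>

lemma sum_over_support_option:
  fixes y :: "'v option \<Rightarrow> real"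
  assumes "finite V" "{v. y (Some v) \<noteq> 0} \<subseteq> V"
  shows "(\<Sum>v | y v \<noteq> 0. y v * w v) = y None * w None + (\<Sum>v\<in>V. y (Some v) * w (Some v))"
proof -
  have "(\<Sum>v | y v \<noteq> 0. y v * w v) = (\<Sum>v\<in>insert None (Some ` V). y v * w v)"
  proof (rule sum.mono_neutral_left)
    show "{v. y v \<noteq> 0} \<subseteq> insert None (Some ` V)"
    proof
      fix v assume "v \<in> {v. y v \<noteq> 0}"
      with assms(2) show "v \<in> insert None (Some ` V)" by (cases v) auto
    qed
  qed (use assms(1) in auto)
  also have "\<dots> = y None * w None + (\<Sum>v\<in>V. y (Some v) * w (Some v))"
    using assms(1) by (subst sum.insert) (auto simp: sum.reindex)
  finally show ?thesis .
qed

lemma in_realization_simplicial_cone_iff: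
  assumes "finite V" "L \<subseteq> Pow V"
  shows "y \<in> topspace (realization (simplicial_cone L)) \<longleftrightarrow>
    (\<forall>v. 0 \<le> y v) \<and> {v. y (Some v) \<noteq> 0} \<in> L \<and> y None + (\<Sum>v\<in>V. y (Some v)) = 1"
proof (cases "{v. y (Some v) \<noteq> 0} \<in> L")
  case True
  then have "{v. y (Some v) \<noteq> 0} \<subseteq> V"
    using assms(2) by blast
  with True show ?thesis
    using sum_over_support_option[OF assms(1), of y "\<lambda>_. 1"]
    by (simp add: realization_def support_in_simplicial_cone_iff)
qed (simp add: realization_def support_in_simplicial_cone_iff)

lemma in_realization_cone_base_iff:
  "y \<in> topspace (realization (cone_base L)) \<longleftrightarrow>
    y \<in> topspace (realization (simplicial_cone L)) \<and> y None = 0"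
  by (simp add: realization_def support_in_simplicial_cone_iff support_in_cone_base_iff) blast

text \<open>The realization is the union of its finitely many closed simplices, and each of these is a
  closed subset of a cube.\<close>

lemma compactin_realization:
  assumes "finite V" "L \<subseteq> Pow V" "\<forall>\<sigma>\<in>L. \<forall>\<tau>\<subseteq>\<sigma>. \<tau> \<in> L"
  shows "compactin (powertop_real UNIV) (topspace (realization L))"
proof -
  have "finite L" using assms(1,2) finite_subset by blast
  define S where "S \<sigma> = (\<Pi>\<^sub>E v\<in>UNIV. if v \<in> \<sigma> then {0..1} else {0}) \<inter> {y. (\<Sum>v\<in>\<sigma>. y v) = (1::real)}" for \<sigma> :: "'a set"
  have "topspace (realization L) = (\<Union>\<sigma>\<in>L. S \<sigma>)"
  proof (intro equalityI subsetI)
    fix y assume "y \<in> topspace (realization L)"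
    then have y: "\<And>v. 0 \<le> y v" "{v. y v \<noteq> 0} \<in> L" "(\<Sum>v | y v \<noteq> 0. y v) = 1"
      by (auto simp: realization_def)
    then have fin: "finite {v. y v \<noteq> 0}" using assms(1,2) finite_subset by blast
    have "y v \<le> 1" if "y v \<noteq> 0" for v
      using member_le_sum[of v "{v. y v \<noteq> 0}" y] y that fin by simp
    with y have "y \<in> S {v. y v \<noteq> 0}" by (auto simp: S_def PiE_iff)
    with y(2) show "y \<in> (\<Union>\<sigma>\<in>L. S \<sigma>)" by blast
  next
    fix y assume "y \<in> (\<Union>\<sigma>\<in>L. S \<sigma>)"
    then obtain \<sigma> where \<sigma>: "\<sigma> \<in> L" and y: "\<And>v. y v \<in> (if v \<in> \<sigma> then {0..1} else {0})" "sum y \<sigma> = 1"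
      by (auto simp: S_def PiE_iff)
    have pos: "0 \<le> y v" for v using y(1)[of v] by (auto split: if_splits)
    have sub: "{v. y v \<noteq> 0} \<subseteq> \<sigma>" using y(1) by (force split: if_splits)
    moreover have "finite \<sigma>" using \<sigma> assms(1,2) finite_subset by blast
    ultimately have "(\<Sum>v | y v \<noteq> 0. y v) = sum y \<sigma>"
      by (intro sum.mono_neutral_left) auto
    with pos sub y(2) bspec[OF assms(3) \<sigma>] show "y \<in> topspace (realization L)"
      by (auto simp: realization_def)
  qed
  moreover have "compactin (powertop_real UNIV) (S \<sigma>)" if "\<sigma> \<in> L" for \<sigma>
  proof -
    have "finite \<sigma>" using that assms(1,2) finite_subset by blast
    have "closedin (powertop_real UNIV) {y \<in> topspace (powertop_real UNIV). (\<Sum>v\<in>\<sigma>. y v) \<in> {1}}"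
      by (rule closedin_continuous_map_preimage[of _ euclideanreal])
        (use \<open>finite \<sigma>\<close> in \<open>auto intro!: continuous_map_sum continuous_map_product_projection\<close>)
    moreover have "compactin (powertop_real UNIV) (\<Pi>\<^sub>E v\<in>UNIV. if v \<in> \<sigma> then {0..1} else {0})"
      by (simp add: compactin_PiE)
    ultimately show ?thesis
      unfolding S_def using compact_Int_closedin by fastforce
  qed
  ultimately show ?thesis
    using \<open>finite L\<close> by (auto intro!: compactin_Union)
qed

lemma topspace_disc: "topspace (disc n) = {u. (\<forall>i\<ge>n. u i = 0) \<and> (\<Sum>i<n. (u i)\<^sup>2) \<le> 1}"
  by (auto simp: disc_def topspace_Euclidean_space)

lemma topspace_bounding_sphere:
  "0 < n \<Longrightarrow> topspace (nsphere (n - 1)) = {u. (\<forall>i\<ge>n. u i = 0) \<and> (\<Sum>i<n. (u i)\<^sup>2) = 1}"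
  by (cases n) (auto simp: nsphere_def topspace_Euclidean_space lessThan_Suc_atMost)

lemma disc_eq: "disc n = subtopology (powertop_real UNIV) (topspace (disc n))"
  by (simp add: disc_def Euclidean_space_def subtopology_subtopology)

lemma compactin_disc: "compactin (powertop_real UNIV) (topspace (disc n))"
proof -
  let ?P = "\<Pi>\<^sub>E i\<in>UNIV. if i < n then {-1..1} else {0::real}"
  have "\<bar>u i\<bar> \<le> 1" if "i < n" "(\<Sum>i<n. (u i)\<^sup>2) \<le> 1" for u :: "nat \<Rightarrow> real" and i
    using member_le_sum[of i "{..<n}" "\<lambda>i. (u i)\<^sup>2"] that abs_square_le_1[of "u i"] by force
  then have "topspace (disc n) =
      ?P \<inter> {u \<in> topspace (powertop_real UNIV). (\<Sum>i<n. (u i)\<^sup>2) \<in> {..1}}"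
    by (force simp: topspace_disc PiE_iff abs_le_iff split: if_splits)
  moreover have "closedin (powertop_real UNIV) {u \<in> topspace (powertop_real UNIV). (\<Sum>i<n. (u i)\<^sup>2) \<in> {..1::real}}"
    by (rule closedin_continuous_map_preimage[of _ euclideanreal])
      (auto intro!: continuous_map_sum continuous_map_real_pow continuous_map_product_projection)
  moreover have "compactin (powertop_real UNIV) ?P"
    by (simp add: compactin_PiE)
  ultimately show ?thesis
    by (simp only: compact_Int_closedin)
qed

lemma closedin_disc_sphere:
  assumes "0 < n"
  shows "closedin (disc n) (topspace (nsphere (n - 1)))"
proof -
  have "topspace (nsphere (n - 1)) = {u \<in> topspace (disc n). (\<Sum>i<n. (u i)\<^sup>2) \<in> {1}}"
    unfolding topspace_bounding_sphere[OF assms] topspace_disc by auto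
  moreover have "continuous_map (disc n) euclideanreal (\<lambda>u. \<Sum>i<n. (u i)\<^sup>2)"
    by (subst disc_eq)
      (auto intro!: continuous_map_from_subtopology continuous_map_sum continuous_map_real_pow continuous_map_product_projection)
  ultimately show ?thesis
    using closedin_continuous_map_preimage[of "disc n" euclideanreal "\<lambda>u. \<Sum>i<n. (u i)\<^sup>2" "{1}"] by simp
qed

lemma realization_eq: "realization L = subtopology (powertop_real UNIV) (topspace (realization L))"
  by (simp add: realization_def)

lemma in_join_sphere_iff:
  assumes "finite V" "L \<subseteq> Pow V" "0 < n"
  shows "(y, u) \<in> topspace (join_sphere L n) \<longleftrightarrow>
    y \<in> topspace (realization (simplicial_cone L)) \<and> u \<in> topspace (disc n) \<and>
    (y None = 0 \<or> (\<Sum>i<n. (u i)\<^sup>2) = 1)"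
  unfolding join_sphere_def topspace_subtopology topspace_prod_topology
    topspace_bounding_sphere[OF assms(3)] topspace_disc
  using in_realization_cone_base_iff[of y] by auto

lemma compact_space_join_sphere:
  assumes "finite V" "L \<subseteq> Pow V" "\<forall>\<sigma>\<in>L. \<forall>\<tau>\<subseteq>\<sigma>. \<tau> \<in> L" "0 < n"
  shows "compact_space (join_sphere L n)"
proof -
  let ?C = "realization (simplicial_cone L)" and ?B = "topspace (realization (cone_base L))"
    and ?D = "disc n" and ?S = "topspace (nsphere (n - 1))"
  have cone: "finite (insert None (Some ` V))" "simplicial_cone L \<subseteq> Pow (insert None (Some ` V))"
    "cone_base L \<subseteq> Pow (insert None (Some ` V))"
    using assms(1,2) by (auto simp: simplicial_cone_def cone_base_def)
  have down_base: "\<forall>\<sigma>\<in>cone_base L. \<forall>\<tau>\<subseteq>\<sigma>. \<tau> \<in> cone_base L"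
  proof (intro ballI allI impI)
    fix \<sigma> \<tau> assume \<sigma>: "\<sigma> \<in> cone_base L" "\<tau> \<subseteq> \<sigma>"
    obtain \<rho> where "\<rho> \<in> L" "\<tau> \<subseteq> Some ` \<rho>" using \<sigma> by (auto simp: cone_base_def)
    then obtain \<rho>' where "\<rho>' \<subseteq> \<rho>" "\<tau> = Some ` \<rho>'" by (meson subset_imageE)
    with \<open>\<rho> \<in> L\<close> assms(3) show "\<tau> \<in> cone_base L" by (auto simp: cone_base_def)
  qed
  have down: "\<forall>\<sigma>\<in>simplicial_cone L. \<forall>\<tau>\<subseteq>\<sigma>. \<tau> \<in> simplicial_cone L"
  proof (intro ballI allI impI)
    fix \<sigma> \<tau> assume \<sigma>: "\<sigma> \<in> simplicial_cone L" "\<tau> \<subseteq> \<sigma>"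
    then obtain \<rho> where "\<rho> \<in> cone_base L" "\<tau> - {None} \<subseteq> \<rho>"
      by (auto simp: simplicial_cone_def)
    with down_base have "\<tau> - {None} \<in> cone_base L"
      by blast
    then show "\<tau> \<in> simplicial_cone L"
      unfolding simplicial_cone_def
      by (cases "None \<in> \<tau>") (auto simp: insert_absorb intro: rev_image_eqI)
  qed
  have C: "compactin ?C (topspace ?C)"
    by (subst realization_eq, subst compactin_subtopology) (auto intro!: compactin_realization[OF cone(1,2) down])
  have B: "compactin ?C ?B"
    by (subst realization_eq, subst compactin_subtopology)
      (auto intro!: compactin_realization[OF cone(1,3) down_base] simp: in_realization_cone_base_iff)
  have D: "compactin ?D (topspace ?D)"
    by (subst disc_eq, subst compactin_subtopology) (auto intro!: compactin_disc)
  have S: "compactin ?D ?S"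
    using closedin_disc_sphere[OF assms(4)] D by (meson closedin_compact_space compact_space_def)
  have "compactin (prod_topology ?C ?D) (topspace ?C \<times> ?S \<union> ?B \<times> topspace ?D)"
    using C B D S by (intro compactin_Un) (auto simp: compactin_Times)
  then show ?thesis
    unfolding join_sphere_def by (simp add: compact_space_subtopology)
qed

text \<open>In barycentric coordinates the apex is the unit vector at \<^term>\<open>None\<close>; so these are straight
  segments, from points of the cone to the apex and from points of the disc to the centre.\<close>

definition toward_apex :: "real \<Rightarrow> ('v option \<Rightarrow> real) \<Rightarrow> 'v option \<Rightarrow> real" where
  "toward_apex s y = (\<lambda>v. (1 - s) * y v + (if v = None then s else 0))"

definition toward_center :: "real \<Rightarrow> (nat \<Rightarrow> real) \<Rightarrow> nat \<Rightarrow> real" where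
  "toward_center s u = (\<lambda>i. (1 - s) * u i)"

lemma toward_apex_simps [simp]:
  "toward_apex s y None = (1 - s) * y None + s" "toward_apex s y (Some v) = (1 - s) * y (Some v)"
  "toward_apex 0 y = y"
  by (auto simp: toward_apex_def)

lemma toward_center_0 [simp]: "toward_center 0 u = u"
  by (simp add: toward_center_def)

lemma toward_apex_in_cone:
  assumes "finite V" "L \<subseteq> Pow V" "{} \<in> L" "y \<in> topspace (realization (simplicial_cone L))" "s \<in> {0..1}"
  shows "toward_apex s y \<in> topspace (realization (simplicial_cone L))"
proof -
  have y: "\<And>v. 0 \<le> y v" "{v. y (Some v) \<noteq> 0} \<in> L" "y None + (\<Sum>v\<in>V. y (Some v)) = 1"
    using assms(4) unfolding in_realization_simplicial_cone_iff[OF assms(1,2)] by auto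
  have "(1 - s) * y None + s + (1 - s) * (\<Sum>v\<in>V. y (Some v)) = (1 - s) * (y None + (\<Sum>v\<in>V. y (Some v))) + s"
    by (simp add: algebra_simps)
  then have "toward_apex s y None + (\<Sum>v\<in>V. toward_apex s y (Some v)) = 1"
    by (simp add: y(3) flip: sum_distrib_left)
  moreover have "0 \<le> toward_apex s y v" for v
    using y(1)[of v] assms(5) by (auto simp: toward_apex_def)
  moreover have "{v. toward_apex s y (Some v) \<noteq> 0} \<in> L"
    using y(2) assms(3) by (cases "s = 1") auto
  ultimately show ?thesis
    unfolding in_realization_simplicial_cone_iff[OF assms(1,2)] by blast
qed

lemma sum_squares_toward_center: "(\<Sum>i<n. (toward_center s u i)\<^sup>2) = (1 - s)\<^sup>2 * (\<Sum>i<n. (u i)\<^sup>2)"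
  by (simp add: toward_center_def power_mult_distrib sum_distrib_left)

lemma toward_center_in_disc:
  assumes "u \<in> topspace (disc n)" "s \<in> {0..1}"
  shows "toward_center s u \<in> topspace (disc n)"
proof -
  have "(1 - s)\<^sup>2 * (\<Sum>i<n. (u i)\<^sup>2) \<le> 1"
    using assms by (intro mult_le_one) (auto simp: topspace_disc sum_nonneg power_le_one)
  with assms(1) show ?thesis
    by (simp add: topspace_disc sum_squares_toward_center) (simp add: toward_center_def)
qed

text \<open>A gauge for the product of cone and disc, which is star-shaped about the pair of apex and
  centre: it is multiplied by \<open>1 - s\<close> along the segments and equals \<open>1\<close> on the join.  Being so
  the boundary of a star-shaped set, the join has the product as its cone.\<close>

definition cone_disc_radius :: "nat \<Rightarrow> ('v option \<Rightarrow> real) \<Rightarrow> (nat \<Rightarrow> real) \<Rightarrow> real" where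
  "cone_disc_radius n y u = max (1 - y None) (L2_set u {..<n})"

lemma cone_disc_radius_toward:
  assumes "s \<le> 1"
  shows "cone_disc_radius n (toward_apex s y) (toward_center s u) = (1 - s) * cone_disc_radius n y u"
proof -
  have "L2_set (toward_center s u) {..<n} = (1 - s) * L2_set u {..<n}"
    using assms by (simp add: toward_center_def L2_set_right_distrib)
  moreover have "1 - toward_apex s y None = (1 - s) * (1 - y None)"
    by (simp add: algebra_simps)
  ultimately show ?thesis
    using assms by (simp add: cone_disc_radius_def max_mult_distrib_left)
qed

lemma cone_disc_radius_join_sphere:
  assumes "finite V" "L \<subseteq> Pow V" "0 < n" "(y, u) \<in> topspace (join_sphere L n)"
  shows "cone_disc_radius n y u = 1"
proof -
  have y: "0 \<le> y None" and u: "(\<Sum>i<n. (u i)\<^sup>2) \<le> 1" and "y None = 0 \<or> (\<Sum>i<n. (u i)\<^sup>2) = 1"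
    using assms(4) unfolding in_join_sphere_iff[OF assms(1-3)]
    by (auto simp: topspace_disc in_realization_simplicial_cone_iff[OF assms(1,2)])
  then show ?thesis
    using real_sqrt_le_mono[OF u] by (auto simp: cone_disc_radius_def L2_set_def)
qed

text \<open>The radius recovers \<open>s\<close>, and for \<open>s < 1\<close> the scaling by \<open>1 - s\<close> can be undone.\<close>

lemma toward_inj:
  assumes "finite V" "L \<subseteq> Pow V" "0 < n"
    and "(y, u) \<in> topspace (join_sphere L n)" "(y', u') \<in> topspace (join_sphere L n)" "s \<le> 1" "t \<le> 1"
    and eq: "toward_apex s y = toward_apex t y'" "toward_center s u = toward_center t u'"
  shows "s = t \<and> ((y, u) = (y', u') \<or> s = 1)"
proof -
  have "1 - s = 1 - t"
    using cone_disc_radius_toward[of s n y u] cone_disc_radius_toward[of t n y' u'] cone_disc_radius_join_sphere[OF assms(1-3)] assms(4-7) eq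
    by simp
  then have "s = t" by simp
  moreover have "y v = y' v" if "s \<noteq> 1" for v
    using fun_cong[OF eq(1), of v] that \<open>s = t\<close> by (simp add: toward_apex_def)
  moreover have "u k = u' k" if "s \<noteq> 1" for k
    using fun_cong[OF eq(2), of k] that \<open>s = t\<close> by (simp add: toward_center_def)
  ultimately show ?thesis by auto
qed

text \<open>A point of radius \<open>r > 0\<close> is reached by stretching it away from the apex and the centre by the
  factor \<open>1 / r\<close>.\<close>

lemma toward_surj:
  assumes "finite V" "L \<subseteq> Pow V" "{} \<in> L" "0 < n"
    and y: "y \<in> topspace (realization (simplicial_cone L))" and u: "u \<in> topspace (disc n)"
  obtains y' u' s where "(y', u') \<in> topspace (join_sphere L n)" "s \<in> {0..1}"
    "toward_apex s y' = y" "toward_center s u' = u"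
proof -
  note cone_iff = in_realization_simplicial_cone_iff[OF assms(1,2)]
  have y0: "\<And>v. 0 \<le> y v" and yL: "{v. y (Some v) \<noteq> 0} \<in> L" and ysum: "y None + (\<Sum>v\<in>V. y (Some v)) = 1"
    using y by (simp_all add: cone_iff)
  have uz: "\<And>i. n \<le> i \<Longrightarrow> u i = 0" and u1: "(\<Sum>i<n. (u i)\<^sup>2) \<le> 1"
    using u by (simp_all add: topspace_disc)
  define r where "r = cone_disc_radius n y u"
  have r0: "0 \<le> r" "1 - y None \<le> r" "L2_set u {..<n} \<le> r"
    by (auto simp: r_def cone_disc_radius_def L2_set_nonneg le_max_iff_disj)
  have r1: "r \<le> 1"
    using real_sqrt_le_mono[OF u1] y0[of None] by (simp add: r_def cone_disc_radius_def L2_set_def)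
  show ?thesis
  proof (cases "r = 0")
    case True
    \<comment> \<open>The apex paired with the centre is the end of every segment; the join is not empty.\<close>
    let ?a = "\<lambda>v. if v = None then 1 else 0" and ?e = "\<lambda>i::nat. if i = 0 then 1 else 0 :: real"
    have "?a \<in> topspace (realization (simplicial_cone L))"
      using assms(3) by (simp add: cone_iff)
    moreover have "(\<forall>i\<ge>n. ?e i = 0) \<and> (\<Sum>i<n. (?e i)\<^sup>2) = 1"
      using in_topspace_nsphere[of "n - 1"] unfolding topspace_bounding_sphere[OF assms(4)] mem_Collect_eq .
    ultimately have join: "(?a, ?e) \<in> topspace (join_sphere L n)"
      unfolding in_join_sphere_iff[OF assms(1,2,4)] topspace_disc by simp
    have "y None = 1"
      using r0 True ysum sum_nonneg[of V "\<lambda>v. y (Some v)"] y0 by force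
    moreover have "y (Some v) = 0" for v
    proof (rule ccontr)
      assume "y (Some v) \<noteq> 0"
      then have "v \<in> V" using yL assms(2) by blast
      moreover have "(\<Sum>v\<in>V. y (Some v)) = 0" using ysum \<open>y None = 1\<close> by simp
      ultimately show False
        using \<open>y (Some v) \<noteq> 0\<close> assms(1) y0 by (simp add: sum_nonneg_eq_0_iff)
    qed
    ultimately have "toward_apex 1 ?a = y"
      by (auto simp: toward_apex_def fun_eq_iff)
    moreover have "u i = 0" for i
    proof (cases "i < n")
      case True
      have "L2_set u {..<n} = 0"
        using r0 \<open>r = 0\<close> L2_set_nonneg[of u "{..<n}"] by simp
      with True show ?thesis by (simp add: L2_set_eq_0_iff)
    qed (use uz in simp)
    then have "toward_center 1 ?e = u"
      by (simp add: toward_center_def fun_eq_iff)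
    ultimately show ?thesis
      using join by (intro that[of ?a ?e 1]) auto
  next
    case False
    with r0 have "0 < r" by simp
    define y' where "y' = (\<lambda>v. (y v - (if v = None then 1 - r else 0)) / r)"
    define u' where "u' = (\<lambda>i. u i / r)"
    have "y' None + (\<Sum>v\<in>V. y' (Some v)) = (y None + (\<Sum>v\<in>V. y (Some v)) - (1 - r)) / r"
      by (simp add: y'_def add_divide_distrib diff_divide_distrib sum_divide_distrib)
    then have "y' None + (\<Sum>v\<in>V. y' (Some v)) = 1"
      using ysum \<open>0 < r\<close> by simp
    moreover have "0 \<le> y' v" for v
      using y0[of v] r0 \<open>0 < r\<close> by (auto simp: y'_def)
    moreover have "{v. y' (Some v) \<noteq> 0} \<in> L"
      using yL \<open>0 < r\<close> by (simp add: y'_def)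
    ultimately have cone: "y' \<in> topspace (realization (simplicial_cone L))"
      by (simp add: cone_iff)
    have L2: "L2_set u' {..<n} = L2_set u {..<n} / r"
      using L2_set_left_distrib[of "1 / r" u "{..<n}"] \<open>0 < r\<close> by (simp add: u'_def)
    then have L2_le: "L2_set u' {..<n} \<le> 1"
      using r0 \<open>0 < r\<close> by simp
    then have disc: "u' \<in> topspace (disc n)"
      using uz by (simp add: topspace_disc L2_set_def) (simp add: u'_def)
    have "y' None = 0 \<or> (\<Sum>i<n. (u' i)\<^sup>2) = 1"
    proof (cases "r = 1 - y None")
      case True
      then show ?thesis by (simp add: y'_def)
    next
      case False
      then have "L2_set u {..<n} = r" by (auto simp: r_def cone_disc_radius_def max_def split: if_splits)
      with L2 \<open>0 < r\<close> show ?thesis by (simp add: L2_set_def)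
    qed
    with cone disc have "(y', u') \<in> topspace (join_sphere L n)"
      by (simp add: in_join_sphere_iff[OF assms(1,2,4)])
    moreover have "toward_apex (1 - r) y' = y" "toward_center (1 - r) u' = u"
      using \<open>0 < r\<close> by (auto simp: toward_apex_def toward_center_def y'_def u'_def)
    ultimately show ?thesis
      using r0 r1 by (intro that[of y' u' "1 - r"]) auto
  qed
qed

section \<open>The map \<open>Cone(i_c)\<close>\<close>

lemma abstract_complexD:
  assumes "abstract_complex I K"
  shows "K \<subseteq> Pow I" "{} \<in> K" "\<forall>\<sigma>\<in>K. \<forall>\<tau>\<subseteq>\<sigma>. \<tau> \<in> K"
  using assms by (simp_all add: abstract_complex_def)

lemma Sd_facts:
  assumes "K \<subseteq> Pow I"
  shows "Sd K \<subseteq> Pow (Pow I)" "{} \<in> Sd K" "\<forall>c\<in>Sd K. \<forall>d\<subseteq>c. d \<in> Sd K"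
proof -
  show "Sd K \<subseteq> Pow (Pow I)"
    unfolding Sd_def using assms by blast
  show "{} \<in> Sd K"
    by (simp add: Sd_def)
  have "d \<in> Sd K" if "c \<in> Sd K" "d \<subseteq> c" for c d
    using that unfolding Sd_def by (simp add: finite_subset[of d c] subset_iff)
  then show "\<forall>c\<in>Sd K. \<forall>d\<subseteq>c. d \<in> Sd K" by blast
qed

lemma cone_Sd_weights:
  assumes "finite I" "K \<subseteq> Pow I" "y \<in> topspace (realization (simplicial_cone (Sd K)))"
  shows "chain_weights I (\<lambda>\<sigma>. y (Some \<sigma>))" "\<And>\<sigma>. y (Some \<sigma>) \<noteq> 0 \<Longrightarrow> \<sigma> \<in> K \<and> \<sigma> \<noteq> {}"
    "y None + (\<Sum>\<sigma>\<in>Pow I. y (Some \<sigma>)) = 1" "\<And>v. 0 \<le> y v"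
    "\<And>\<sigma> \<tau>. \<lbrakk>y (Some \<sigma>) \<noteq> 0; y (Some \<tau>) \<noteq> 0\<rbrakk> \<Longrightarrow> \<sigma> \<subseteq> \<tau> \<or> \<tau> \<subseteq> \<sigma>"
proof -
  have "finite (Pow I)" using assms(1) by simp
  note iff = in_realization_simplicial_cone_iff[OF this Sd_facts(1)[OF assms(2)], of y]
  show "y None + (\<Sum>\<sigma>\<in>Pow I. y (Some \<sigma>)) = 1" and pos: "\<And>v. 0 \<le> y v"
    using assms(3) unfolding iff by blast+
  have "{\<sigma>. y (Some \<sigma>) \<noteq> 0} \<in> Sd K"
    using assms(3) unfolding iff by blast
  then have Sd: "\<And>\<sigma>. y (Some \<sigma>) \<noteq> 0 \<Longrightarrow> \<sigma> \<in> K - {{}}"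
    "\<And>\<sigma> \<tau>. \<lbrakk>y (Some \<sigma>) \<noteq> 0; y (Some \<tau>) \<noteq> 0\<rbrakk> \<Longrightarrow> \<sigma> \<subseteq> \<tau> \<or> \<tau> \<subseteq> \<sigma>"
    unfolding Sd_def by blast+
  then show "\<And>\<sigma>. y (Some \<sigma>) \<noteq> 0 \<Longrightarrow> \<sigma> \<in> K \<and> \<sigma> \<noteq> {}" by blast
  show "\<And>\<sigma> \<tau>. \<lbrakk>y (Some \<sigma>) \<noteq> 0; y (Some \<tau>) \<noteq> 0\<rbrakk> \<Longrightarrow> \<sigma> \<subseteq> \<tau> \<or> \<tau> \<subseteq> \<sigma>" by (fact Sd(2))
  show "chain_weights I (\<lambda>\<sigma>. y (Some \<sigma>))"
    unfolding chain_weights_def using pos Sd assms(2) by blast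
qed

text \<open>The \<open>j\<close>-th coordinate of a vertex \<open>\<sigma>\<close> is \<open>1\<close> minus twice the indicator of \<open>j \<in> \<sigma>\<close>, and
  the barycentric coordinates have sum \<open>1\<close>.  Through this formula \<^const>\<open>cone_ic\<close> is governed by the
  theory of heights.\<close>

lemma cone_ic_eq_height:
  assumes "finite I" "K \<subseteq> Pow I" "y \<in> topspace (realization (simplicial_cone (Sd K)))"
  shows "cone_ic y j = 1 - 2 * height I (\<lambda>\<sigma>. y (Some \<sigma>)) j"
proof -
  have "{\<sigma>. y (Some \<sigma>) \<noteq> 0} \<subseteq> Pow I"
    using cone_Sd_weights(2)[OF assms] assms(2) by blast
  then have "cone_ic y j = y None * cone_ic_vertex None j + (\<Sum>\<sigma>\<in>Pow I. y (Some \<sigma>) * cone_ic_vertex (Some \<sigma>) j)"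
    unfolding cone_ic_def using assms(1) by (intro sum_over_support_option) auto
  also have "\<dots> = y None + (\<Sum>\<sigma>\<in>Pow I. y (Some \<sigma>) - 2 * (if j \<in> \<sigma> then y (Some \<sigma>) else 0))"
    by (intro arg_cong2[of _ _ _ _ "(+)"] sum.cong) (auto simp: cone_ic_vertex_def)
  also have "\<dots> = 1 - 2 * (\<Sum>\<sigma>\<in>Pow I. if j \<in> \<sigma> then y (Some \<sigma>) else 0)"
    using cone_Sd_weights(3)[OF assms] by (simp add: sum_subtractf sum_distrib_left)
  also have "(\<Sum>\<sigma>\<in>Pow I. if j \<in> \<sigma> then y (Some \<sigma>) else 0) = height I (\<lambda>\<sigma>. y (Some \<sigma>)) j"
    unfolding height_def using assms(1) by (simp add: sum.If_cases Collect_conj_eq Pow_def Int_commute)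
  finally show ?thesis .
qed

lemma height_bounds:
  assumes "finite I" "\<And>\<sigma>. 0 \<le> c \<sigma>"
  shows "0 \<le> height I c j" "height I c j \<le> sum c (Pow I)"
  unfolding height_def using assms by (auto intro!: sum_nonneg sum_mono2)

lemma cone_ic_range:
  assumes "finite I" "K \<subseteq> Pow I" "y \<in> topspace (realization (simplicial_cone (Sd K)))"
  shows "cone_ic y j \<in> {-1..1}"
proof -
  note w = cone_Sd_weights[OF assms]
  have "0 \<le> height I (\<lambda>\<sigma>. y (Some \<sigma>)) j" "height I (\<lambda>\<sigma>. y (Some \<sigma>)) j \<le> 1 - y None"
    using height_bounds[of I "\<lambda>\<sigma>. y (Some \<sigma>)" j] assms(1) w(3,4) by (simp_all add: algebra_simps)
  with w(4)[of None] show ?thesis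
    by (simp add: cone_ic_eq_height[OF assms])
qed

lemma cone_ic_inj:
  assumes "finite I" "K \<subseteq> Pow I"
    and y: "y \<in> topspace (realization (simplicial_cone (Sd K)))"
    and y': "y' \<in> topspace (realization (simplicial_cone (Sd K)))"
    and eq: "\<And>j. j \<in> I \<Longrightarrow> cone_ic y j = cone_ic y' j"
  shows "y = y'"
proof -
  note w = cone_Sd_weights[OF assms(1,2) y] and w' = cone_Sd_weights[OF assms(1,2) y']
  have height: "height I (\<lambda>\<sigma>. y (Some \<sigma>)) j = height I (\<lambda>\<sigma>. y' (Some \<sigma>)) j" if "j \<in> I" for j
    using eq[OF that] by (simp add: cone_ic_eq_height[OF assms(1,2) y] cone_ic_eq_height[OF assms(1,2) y'])
  have Some: "y (Some \<sigma>) = y' (Some \<sigma>)" for \<sigma>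
  proof (cases "\<sigma> \<subseteq> I \<and> \<sigma> \<noteq> {}")
    case True
    then show ?thesis
      using chain_weights_unique[OF assms(1) w(1) w'(1) height, of \<sigma>] by blast
  next
    case False
    then have "\<not> (\<sigma> \<in> K \<and> \<sigma> \<noteq> {})" using assms(2) by blast
    with w(2) w'(2) show ?thesis by metis
  qed
  then have "y None = y' None"
    using w(3) w'(3) by simp
  with Some show ?thesis
    by (metis ext option.exhaust)
qed

text \<open>All members of the layer-cake chain for the heights \<open>(1 - t j) / 2\<close> lie in the set where
  \<open>t < 1\<close>; so the chain is a simplex of the subdivision as soon as this set is in \<open>K\<close>.\<close>

lemma cone_ic_surj:
  assumes "finite I" "K \<subseteq> Pow I" "\<forall>\<sigma>\<in>K. \<forall>\<tau>\<subseteq>\<sigma>. \<tau> \<in> K"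
    and t: "\<forall>j\<in>I. t j \<in> {-1..1}" and K: "{j \<in> I. t j < 1} \<in> K"
  shows "\<exists>y\<in>topspace (realization (simplicial_cone (Sd K))). \<forall>j\<in>I. cone_ic y j = t j"
proof -
  have "\<forall>j\<in>I. 0 \<le> (1 - t j) / 2 \<and> (1 - t j) / 2 \<le> 1"
    using t by auto
  from chain_weights_exist[OF assms(1) this]
  obtain c where c: "chain_weights I c" and height: "\<forall>j\<in>I. height I c j = (1 - t j) / 2"
    and supp: "\<forall>\<sigma>. c \<sigma> \<noteq> 0 \<longrightarrow> \<sigma> \<subseteq> {j \<in> I. 0 < (1 - t j) / 2}" and total: "sum c (Pow I) = 1"
    by (elim exE conjE)
  \<comment> \<open>The levels whose superlevel set is empty contribute the weight of the cone point.\<close>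
  define y where "y v = (case v of None \<Rightarrow> c {} | Some \<sigma> \<Rightarrow> if \<sigma> = {} then 0 else c \<sigma>)" for v
  have "y None + (\<Sum>\<sigma>\<in>Pow I. y (Some \<sigma>)) = sum c (Pow I)"
  proof -
    have "(\<Sum>\<sigma>\<in>Pow I. y (Some \<sigma>)) = (\<Sum>\<sigma>\<in>Pow I - {{}}. c \<sigma>)"
      using assms(1) by (intro sum.mono_neutral_cong_right) (auto simp: y_def)
    then show ?thesis
      using assms(1) sum.remove[of "Pow I" "{}" c] by (simp add: y_def)
  qed
  moreover have "{\<sigma>. y (Some \<sigma>) \<noteq> 0} \<in> Sd K"
  proof -
    have nz: "\<sigma> \<noteq> {} \<and> c \<sigma> \<noteq> 0" if "y (Some \<sigma>) \<noteq> 0" for \<sigma>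
      using that by (auto simp: y_def split: if_splits)
    have "\<sigma> \<in> K" if "c \<sigma> \<noteq> 0" for \<sigma>
    proof -
      have "\<sigma> \<subseteq> {j \<in> I. t j < 1}" using supp that by auto
      with assms(3) K show ?thesis by blast
    qed
    with nz have sub: "{\<sigma>. y (Some \<sigma>) \<noteq> 0} \<subseteq> K - {{}}" by blast
    moreover have "finite K" using assms(1,2) by (meson finite_Pow_iff finite_subset)
    ultimately have "finite {\<sigma>. y (Some \<sigma>) \<noteq> 0}" using finite_subset by blast
    with sub nz c show ?thesis
      unfolding Sd_def chain_weights_def by blast
  qed
  moreover have "0 \<le> y v" for v
    using c by (auto simp: y_def chain_weights_def split: option.split)
  moreover have "finite (Pow I)" using assms(1) by simp
  ultimately have y: "y \<in> topspace (realization (simplicial_cone (Sd K)))"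
    using total by (subst in_realization_simplicial_cone_iff[OF _ Sd_facts(1)[OF assms(2)]]) auto
  have "height I (\<lambda>\<sigma>. y (Some \<sigma>)) j = height I c j" for j
    unfolding height_def by (rule sum.cong) (auto simp: y_def)
  then have "cone_ic y j = t j" if "j \<in> I" for j
    using bspec[OF height that] by (simp add: cone_ic_eq_height[OF assms(1,2) y])
  with y show ?thesis by blast
qed

text \<open>An index with coordinate less than \<open>1\<close> lies in some member of the chain supporting \<open>y\<close>, hence
  in the largest one.\<close>

lemma cone_ic_less_1_in_K:
  assumes "finite I" "K \<subseteq> Pow I" "{} \<in> K" "\<forall>\<sigma>\<in>K. \<forall>\<tau>\<subseteq>\<sigma>. \<tau> \<in> K"
    and y: "y \<in> topspace (realization (simplicial_cone (Sd K)))"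
  shows "{j \<in> I. cone_ic y j < 1} \<in> K"
proof -
  note w = cone_Sd_weights[OF assms(1,2) y]
  define S where "S = {\<sigma>. y (Some \<sigma>) \<noteq> 0}"
  have supp: "\<exists>\<sigma>\<in>S. j \<in> \<sigma>" if "cone_ic y j < 1" for j
  proof (rule ccontr)
    assume "\<not> (\<exists>\<sigma>\<in>S. j \<in> \<sigma>)"
    then have "height I (\<lambda>\<sigma>. y (Some \<sigma>)) j = 0"
      unfolding height_def S_def by (intro sum.neutral) auto
    with that show False by (simp add: cone_ic_eq_height[OF assms(1,2) y])
  qed
  show ?thesis
  proof (cases "S = {}")
    case True
    with supp have "{j \<in> I. cone_ic y j < 1} = {}" by auto
    with assms(3) show ?thesis by metis
  next
    case False
    have "S \<subseteq> Pow I" using w(2) assms(2) by (auto simp: S_def)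
    then have "finite S" using assms(1) by (meson finite_Pow_iff finite_subset)
    with False obtain \<rho> where \<rho>: "\<rho> \<in> S" "\<And>\<sigma>. \<lbrakk>\<sigma> \<in> S; \<rho> \<subseteq> \<sigma>\<rbrakk> \<Longrightarrow> \<sigma> = \<rho>"
      using finite_has_maximal[of S] by metis
    have "\<sigma> \<subseteq> \<rho>" if "\<sigma> \<in> S" for \<sigma>
    proof -
      have "\<sigma> \<subseteq> \<rho> \<or> \<rho> \<subseteq> \<sigma>"
        using that \<rho>(1) by (intro w(5)) (simp_all add: S_def)
      with \<rho>(2)[OF that] show ?thesis by blast
    qed
    with supp have "{j \<in> I. cone_ic y j < 1} \<subseteq> \<rho>" by blast
    moreover have "\<rho> \<in> K" using \<rho>(1) w(2) by (simp add: S_def)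
    ultimately show ?thesis using assms(4) by blast
  qed
qed

text \<open>A chain of non-empty sets has a common element, and at such an element the height is the
  total weight.\<close>

lemma cone_ic_eq_minus1_iff:
  assumes "finite I" "K \<subseteq> Pow I"
    and y: "y \<in> topspace (realization (simplicial_cone (Sd K)))"
  shows "(\<exists>j\<in>I. cone_ic y j = -1) \<longleftrightarrow> y None = 0"
proof
  note w = cone_Sd_weights[OF assms(1,2) y]
  {
    assume "\<exists>j\<in>I. cone_ic y j = -1"
    then obtain j where "height I (\<lambda>\<sigma>. y (Some \<sigma>)) j = 1"
      by (auto simp: cone_ic_eq_height[OF assms(1,2) y])
    moreover have "height I (\<lambda>\<sigma>. y (Some \<sigma>)) j \<le> (\<Sum>\<sigma>\<in>Pow I. y (Some \<sigma>))"
      by (rule height_bounds(2)[OF assms(1) w(4)])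
    ultimately show "y None = 0"
      using w(3) w(4)[of None] by linarith
  }
  assume y0: "y None = 0"
  define S where "S = {\<sigma>. y (Some \<sigma>) \<noteq> 0}"
  have "S \<noteq> {}"
  proof
    assume "S = {}"
    then have "(\<Sum>\<sigma>\<in>Pow I. y (Some \<sigma>)) = 0" by (simp add: S_def)
    with w(3) y0 show False by simp
  qed
  have "S \<subseteq> Pow I" using w(2) assms(2) by (auto simp: S_def)
  then have "finite S" using assms(1) by (meson finite_Pow_iff finite_subset)
  with \<open>S \<noteq> {}\<close> obtain \<rho> where \<rho>: "\<rho> \<in> S" "\<And>\<sigma>. \<lbrakk>\<sigma> \<in> S; \<sigma> \<subseteq> \<rho>\<rbrakk> \<Longrightarrow> \<sigma> = \<rho>"
    using finite_has_minimal[of S] by metis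
  have "\<rho> \<noteq> {}" using w(2)[of \<rho>] \<rho>(1) by (simp add: S_def)
  then obtain j where "j \<in> \<rho>" by blast
  have j: "j \<in> \<sigma>" if "\<sigma> \<in> S" for \<sigma>
  proof -
    have "\<sigma> \<subseteq> \<rho> \<or> \<rho> \<subseteq> \<sigma>"
      using that \<rho>(1) by (intro w(5)) (simp_all add: S_def)
    with \<rho>(2)[OF that] \<open>j \<in> \<rho>\<close> show ?thesis by blast
  qed
  have "height I (\<lambda>\<sigma>. y (Some \<sigma>)) j = (\<Sum>\<sigma>\<in>Pow I. y (Some \<sigma>))"
    unfolding height_def using assms(1) j by (intro sum.mono_neutral_left) (auto simp: S_def)
  then have "cone_ic y j = -1"
    using w(3) y0 by (simp add: cone_ic_eq_height[OF assms(1,2) y])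
  then show "\<exists>j\<in>I. cone_ic y j = -1"
    using \<open>j \<in> \<rho>\<close> \<rho>(1) \<open>S \<subseteq> Pow I\<close> by blast
qed

lemma continuous_map_realization_coordinate:
  "continuous_map (realization L) euclideanreal (\<lambda>y. y v)"
  by (subst realization_eq) (auto intro: continuous_map_from_subtopology continuous_map_product_projection)

lemma continuous_map_cone_ic:
  assumes "finite I" "K \<subseteq> Pow I"
  shows "continuous_map (realization (simplicial_cone (Sd K))) (top_of_set {-1..1}) (\<lambda>y. cone_ic y j)"
proof -
  have "continuous_map (realization (simplicial_cone (Sd K))) euclideanreal
      (\<lambda>y. 1 - 2 * height I (\<lambda>\<sigma>. y (Some \<sigma>)) j)"
    unfolding height_def using assms(1)
    by (intro continuous_map_diff continuous_map_real_mult continuous_map_sum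
        continuous_map_realization_coordinate) auto
  then have "continuous_map (realization (simplicial_cone (Sd K))) euclideanreal (\<lambda>y. cone_ic y j)"
    by (rule continuous_map_eq) (simp add: cone_ic_eq_height[OF assms])
  then show ?thesis
    using cone_ic_range[OF assms] by (auto simp: continuous_map_in_subtopology)
qed

section \<open>The fat wedge filtration\<close>

lemma in_moment_angle_iff:
  "z \<in> topspace (moment_angle V K) \<longleftrightarrow>
    z \<in> (\<Pi>\<^sub>E j\<in>V. topspace D2) \<and> (\<exists>\<sigma>\<in>K. \<forall>j\<in>V - \<sigma>. z j \<in> D2_circle)"
proof -
  have "z \<in> (\<Pi>\<^sub>E j\<in>V. if j \<in> \<sigma> then topspace D2 else D2_circle) \<longleftrightarrow>
      z \<in> (\<Pi>\<^sub>E j\<in>V. topspace D2) \<and> (\<forall>j\<in>V - \<sigma>. z j \<in> D2_circle)" for \<sigma>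
    using D2_circle_subset by (auto simp: PiE_iff)
  then show ?thesis
    unfolding moment_angle_def by (auto simp: topspace_product_topology)
qed

text \<open>Counting the coordinates off the basepoint avoids the truncated difference in the
  definition of the filtration.\<close>

lemma in_fat_wedge_filtration_iff:
  assumes "finite V" "k \<le> card V"
  shows "z \<in> topspace (fat_wedge_filtration V K k) \<longleftrightarrow>
    z \<in> topspace (moment_angle V K) \<and> card {j \<in> V. z j \<noteq> D2_base} \<le> k"
proof -
  have "card {j \<in> V. z j = D2_base} + card {j \<in> V. z j \<noteq> D2_base} = card V"
    using assms(1) by (subst card_Un_disjoint[symmetric]) (auto intro!: arg_cong[of _ _ card])
  then show ?thesis
    using assms(2) by (auto simp: fat_wedge_filtration_def)
qed

lemma fat_wedge_filtration_eq:
  "fat_wedge_filtration V K k =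
    subtopology (product_topology (\<lambda>_. D2) V) (topspace (fat_wedge_filtration V K k))"
  unfolding fat_wedge_filtration_def moment_angle_def subtopology_subtopology
  by (simp only: topspace_subtopology subtopology_restrict)

lemma Hausdorff_fat_wedge_filtration: "Hausdorff_space (fat_wedge_filtration V K k)"
  unfolding fat_wedge_filtration_def moment_angle_def
  by (intro Hausdorff_space_subtopology) (simp add: Hausdorff_space_product_topology Hausdorff_D2)

text \<open>Each stage is a finite union of products of compact sets: choose a simplex of \<open>K\<close> and
  the set of coordinates that may differ from the basepoint.\<close>

lemma compact_fat_wedge_filtration:
  assumes "finite V" "K \<subseteq> Pow V" "k \<le> card V"
  shows "compact_space (fat_wedge_filtration V K k)"
proof -
  let ?X = "product_topology (\<lambda>_. D2) V"
  define P where "P \<sigma> T = (\<Pi>\<^sub>E j\<in>V. if j \<in> T then if j \<in> \<sigma> then topspace D2 else D2_circle else {D2_base})"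
    for \<sigma> T
  have "topspace (fat_wedge_filtration V K k) = (\<Union>\<sigma>\<in>K. \<Union>T\<in>{T. T \<subseteq> V \<and> card T \<le> k}. P \<sigma> T)"
  proof (intro equalityI subsetI)
    fix z assume "z \<in> topspace (fat_wedge_filtration V K k)"
    then obtain \<sigma> where "\<sigma> \<in> K" "z \<in> (\<Pi>\<^sub>E j\<in>V. topspace D2)" "\<forall>j\<in>V - \<sigma>. z j \<in> D2_circle"
      and card: "card {j \<in> V. z j \<noteq> D2_base} \<le> k"
      unfolding in_fat_wedge_filtration_iff[OF assms(1,3)] in_moment_angle_iff by blast
    then have "z \<in> P \<sigma> {j \<in> V. z j \<noteq> D2_base}"
      by (auto simp: P_def PiE_iff)
    moreover have "{j \<in> V. z j \<noteq> D2_base} \<in> {T. T \<subseteq> V \<and> card T \<le> k}"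
      using card by simp
    ultimately show "z \<in> (\<Union>\<sigma>\<in>K. \<Union>T\<in>{T. T \<subseteq> V \<and> card T \<le> k}. P \<sigma> T)"
      using \<open>\<sigma> \<in> K\<close> by (intro UN_I)
  next
    fix z assume "z \<in> (\<Union>\<sigma>\<in>K. \<Union>T\<in>{T. T \<subseteq> V \<and> card T \<le> k}. P \<sigma> T)"
    then obtain \<sigma> T where "\<sigma> \<in> K" and T: "T \<subseteq> V" "card T \<le> k"
      and z: "z \<in> extensional V"
        "\<And>j. j \<in> V \<Longrightarrow> z j \<in> (if j \<in> T then if j \<in> \<sigma> then topspace D2 else D2_circle else {D2_base})"
      by (auto simp: P_def PiE_iff)
    have "finite T" using T(1) assms(1) finite_subset by blast
    have "z j = D2_base" if "j \<in> V" "j \<notin> T" for j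
      using z(2)[OF that(1)] that(2) by simp
    then have "{j \<in> V. z j \<noteq> D2_base} \<subseteq> T" by blast
    from card_mono[OF \<open>finite T\<close> this] have "card {j \<in> V. z j \<noteq> D2_base} \<le> k" using T(2) by simp
    moreover have "z j \<in> D2_circle" if "j \<in> V - \<sigma>" for j
      using z(2)[of j] that D2_base_in_circle by (auto split: if_splits)
    moreover have "z j \<in> topspace D2" if "j \<in> V" for j
      using z(2)[OF that] D2_base_in_D2 D2_circle_subset by (auto split: if_splits)
    ultimately show "z \<in> topspace (fat_wedge_filtration V K k)"
      unfolding in_fat_wedge_filtration_iff[OF assms(1,3)] in_moment_angle_iff
      using z(1) \<open>\<sigma> \<in> K\<close> by (auto simp: PiE_iff)
  qed
  moreover have "compactin ?X (P \<sigma> T)" for \<sigma> T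
    unfolding P_def using compact_D2 compactin_D2_circle D2_base_in_D2
    by (subst compactin_PiE) (auto simp: compact_space_def)
  moreover have "finite K" using assms(1,2) by (meson finite_Pow_iff finite_subset)
  ultimately have "compactin ?X (topspace (fat_wedge_filtration V K k))"
    using assms(1) by (auto intro!: compactin_Union)
  then show ?thesis
    by (subst fat_wedge_filtration_eq) (simp add: compact_space_subtopology)
qed

section \<open>The characteristic map of one cone\<close>

text \<open>The same formula serves on the whole product of cone and disc; on the join it is the attaching
  map.\<close>

definition cell_map ::
    "nat set \<Rightarrow> nat set \<Rightarrow> ((nat \<Rightarrow> real) \<Rightarrow> nat \<Rightarrow> complex)
      \<Rightarrow> (nat set option \<Rightarrow> real) \<times> (nat \<Rightarrow> real) \<Rightarrow> nat \<Rightarrow> (complex \<times> real) set" where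
  "cell_map V I q = base_extend I V \<circ> phi_hat I q"

lemma cell_map_apply:
  "I \<subseteq> V \<Longrightarrow> cell_map V I q (y, u) =
    (\<lambda>j\<in>V. if j \<in> I then D2_pt (cone_ic y j) (q u j) else D2_base)"
  by (auto simp: cell_map_def base_extend_def phi_hat_def Phi_def fun_eq_iff)

text \<open>The homeomorphism off the fat wedge, rephrased in terms of coordinates.  The coordinates of
  \<open>q u\<close> avoid the basepoint exactly for \<open>u\<close> in the open disc, and there they determine \<open>u\<close>.\<close>

lemma top_cell_mapD:
  assumes "top_cell_map I q" "0 < card I"
  shows "continuous_map (disc (card I)) (torus I) q"
    and "\<And>u j. \<lbrakk>u \<in> topspace (disc (card I)); j \<in> I\<rbrakk> \<Longrightarrow> q u j \<in> sphere 0 1"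
    and "\<And>u. u \<in> topspace (disc (card I)) \<Longrightarrow> (\<exists>j\<in>I. q u j = 1) \<longleftrightarrow> (\<Sum>i<card I. (u i)\<^sup>2) = 1"
    and "\<And>u u'. \<lbrakk>u \<in> topspace (disc (card I)); u' \<in> topspace (disc (card I)); \<And>j. j \<in> I \<Longrightarrow> q u j \<noteq> 1;
      \<And>j. j \<in> I \<Longrightarrow> q u j = q u' j\<rbrakk> \<Longrightarrow> u = u'"
    and "\<And>x. \<forall>j\<in>I. x j \<in> sphere 0 1 \<and> x j \<noteq> 1 \<Longrightarrow>
      \<exists>u\<in>topspace (disc (card I)). \<forall>j\<in>I. q u j = x j"
proof -
  let ?D = "topspace (disc (card I))" and ?S = "topspace (nsphere (card I - 1))"
  have S: "?S = {u \<in> ?D. (\<Sum>i<card I. (u i)\<^sup>2) = 1}"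
    unfolding topspace_bounding_sphere[OF assms(2)] topspace_disc by auto
  show cont: "continuous_map (disc (card I)) (torus I) q"
    using assms(1) by (simp add: top_cell_map_def)
  have T: "topspace (torus I) = (\<Pi>\<^sub>E j\<in>I. sphere 0 1)"
    by (simp add: torus_def)
  have qT: "q u \<in> (\<Pi>\<^sub>E j\<in>I. sphere 0 1)" if "u \<in> ?D" for u
    using continuous_map_image_subset_topspace[OF cont] that unfolding T by blast
  then show "q u j \<in> sphere 0 1" if "u \<in> ?D" "j \<in> I" for u j
    using that by blast
  have bd: "q ` ?S \<subseteq> torus_fat_wedge I"
    using assms(1) by (simp add: top_cell_map_def)
  have "homeomorphic_map (subtopology (disc (card I)) (?D - ?S))
      (subtopology (torus I) (topspace (torus I) - torus_fat_wedge I)) q"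
    using assms(1) by (simp add: top_cell_map_def)
  then have inj: "inj_on q (?D - ?S)" and img: "q ` (?D - ?S) = topspace (torus I) - torus_fat_wedge I"
    by (auto simp: homeomorphic_eq_everything_map Int_absorb1 Diff_subset)
  have fat: "torus_fat_wedge I = {x \<in> topspace (torus I). \<exists>j\<in>I. x j = 1}"
    by (simp add: torus_fat_wedge_def)
  show iff: "(\<exists>j\<in>I. q u j = 1) \<longleftrightarrow> (\<Sum>i<card I. (u i)\<^sup>2) = 1" if "u \<in> ?D" for u
  proof
    assume "(\<Sum>i<card I. (u i)\<^sup>2) = 1"
    with that have "u \<in> ?S" unfolding S by simp
    with bd have "q u \<in> torus_fat_wedge I" by blast
    then show "\<exists>j\<in>I. q u j = 1" unfolding fat by simp
  next
    assume "\<exists>j\<in>I. q u j = 1"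
    with qT[OF that] have "q u \<in> torus_fat_wedge I" unfolding fat T by blast
    with img have "u \<notin> ?D - ?S" by blast
    with that show "(\<Sum>i<card I. (u i)\<^sup>2) = 1" unfolding S by simp
  qed
  show "u = u'" if "u \<in> ?D" "u' \<in> ?D" "\<And>j. j \<in> I \<Longrightarrow> q u j \<noteq> 1" "\<And>j. j \<in> I \<Longrightarrow> q u j = q u' j" for u u'
  proof -
    have "q u = q u'"
      using PiE_ext[OF qT[OF that(1)] qT[OF that(2)]] that(4) by blast
    moreover have "(\<Sum>i<card I. (u i)\<^sup>2) \<noteq> 1" "(\<Sum>i<card I. (u' i)\<^sup>2) \<noteq> 1"
      using iff[OF that(1)] iff[OF that(2)] that(3,4) by metis+
    then have "u \<in> ?D - ?S" "u' \<in> ?D - ?S"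
      using that(1,2) unfolding S by auto
    ultimately show ?thesis using inj by (simp add: inj_on_eq_iff)
  qed
  show "\<exists>u\<in>?D. \<forall>j\<in>I. q u j = x j" if "\<forall>j\<in>I. x j \<in> sphere 0 1 \<and> x j \<noteq> 1" for x
  proof -
    have "restrict x I \<in> topspace (torus I) - torus_fat_wedge I"
      using that unfolding fat T by auto
    then obtain u where "u \<in> ?D" "restrict x I = q u"
      unfolding img[symmetric] by blast
    then show ?thesis by (metis restrict_apply')
  qed
qed

locale cell =
  fixes V I :: "nat set" and K :: "nat set set" and q :: "(nat \<Rightarrow> real) \<Rightarrow> nat \<Rightarrow> complex"
  assumes finite_V: "finite V" and K: "abstract_complex V K"
    and I: "I \<subseteq> V" "I \<noteq> {}" and q: "top_cell_map I q"
begin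

abbreviation "L \<equiv> Sd (full_subcomplex K I)"
abbreviation "C \<equiv> realization (simplicial_cone L)"
abbreviation "D \<equiv> disc (card I)"
abbreviation "\<Psi> \<equiv> cell_map V I q"

lemma finite_I: "finite I" and finite_Pow_I: "finite (Pow I)" and card_I: "0 < card I"
  and card_le: "card I \<le> card V"
  using finite_V I by (auto simp: finite_subset card_gt_0_iff intro: card_mono)

lemma KI: "full_subcomplex K I \<subseteq> Pow I" "{} \<in> full_subcomplex K I"
  "\<forall>\<sigma>\<in>full_subcomplex K I. \<forall>\<tau>\<subseteq>\<sigma>. \<tau> \<in> full_subcomplex K I"
  using abstract_complexD[OF abstract_complex_full_subcomplex[OF K I(1)]] by simp_all

lemmas LV = Sd_facts(1)[OF KI(1)]
lemmas ic_range = cone_ic_range[OF finite_I KI(1)]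
lemmas qD = top_cell_mapD[OF q card_I]

lemma \<Psi>_apply: "j \<in> I \<Longrightarrow> \<Psi> (y, u) j = D2_pt (cone_ic y j) (q u j)"
  "j \<in> V - I \<Longrightarrow> \<Psi> (y, u) j = D2_base"
  using I(1) by (auto simp: cell_map_apply)

lemma \<Psi>_base_iff:
  assumes "y \<in> topspace C" "u \<in> topspace D" "j \<in> I"
  shows "\<Psi> (y, u) j = D2_base \<longleftrightarrow> cone_ic y j = -1 \<or> q u j = 1"
  unfolding \<Psi>_apply(1)[OF assms(3)]
  by (rule D2_pt_eq_base_iff[OF qD(2)[OF assms(2,3)] ic_range[OF assms(1)]])

lemma nonbase_subset: "{j \<in> V. \<Psi> (y, u) j \<noteq> D2_base} \<subseteq> I"
  using \<Psi>_apply(2) by blast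

lemma \<Psi>_in_moment_angle:
  assumes "y \<in> topspace C" "u \<in> topspace D"
  shows "\<Psi> (y, u) \<in> topspace (moment_angle V K)"
proof -
  have in_D2: "\<Psi> (y, u) j \<in> topspace D2" if "j \<in> V" for j
    using that D2_pt_in_D2[OF qD(2)[OF assms(2)] ic_range[OF assms(1)]] D2_base_in_D2
    by (cases "j \<in> I") (simp_all add: \<Psi>_apply)
  moreover have "\<Psi> (y, u) \<in> extensional V"
    by (simp add: cell_map_def base_extend_def)
  moreover have "{j \<in> I. cone_ic y j < 1} \<in> K"
    using cone_ic_less_1_in_K[OF finite_I KI assms(1)] by (simp add: full_subcomplex_def)
  moreover have "\<Psi> (y, u) j \<in> D2_circle" if "j \<in> V - {j \<in> I. cone_ic y j < 1}" for j
  proof (cases "j \<in> I")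
    case True
    with that ic_range[OF assms(1), of j] have "cone_ic y j = 1" by simp
    with True qD(2)[OF assms(2)] show ?thesis
      by (simp add: \<Psi>_apply D2_circle_def)
  next
    case False
    with that show ?thesis by (simp add: \<Psi>_apply D2_base_in_circle)
  qed
  ultimately show ?thesis
    unfolding in_moment_angle_iff PiE_iff by blast
qed

lemma \<Psi>_in_filtration:
  assumes "y \<in> topspace C" "u \<in> topspace D"
  shows "\<Psi> (y, u) \<in> topspace (fat_wedge_filtration V K (card I))"
  unfolding in_fat_wedge_filtration_iff[OF finite_V card_le]
  using \<Psi>_in_moment_angle[OF assms] card_mono[OF finite_I nonbase_subset] by blast

text \<open>A coordinate can reach the basepoint of the reduced cone in two ways: its cone parameter is
  \<open>-1\<close>, which happens on the base of the simplicial cone, or its circle component is \<open>1\<close>, which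
  happens on the bounding sphere of the disc.  The two alternatives make up the join.\<close>

lemma some_coordinate_base_iff:
  assumes "y \<in> topspace C" "u \<in> topspace D"
  shows "(\<exists>j\<in>I. \<Psi> (y, u) j = D2_base) \<longleftrightarrow> (y, u) \<in> topspace (join_sphere L (card I))"
  unfolding in_join_sphere_iff[OF finite_Pow_I LV card_I]
  using \<Psi>_base_iff[OF assms] cone_ic_eq_minus1_iff[OF finite_I KI(1) assms(1)] qD(3)[OF assms(2)] assms
  by blast

lemma \<Psi>_boundary:
  assumes "(y, u) \<in> topspace (join_sphere L (card I))"
  shows "\<Psi> (y, u) \<in> topspace (fat_wedge_filtration V K (card I - 1))"
proof -
  have yu: "y \<in> topspace C" "u \<in> topspace D"
    using assms unfolding in_join_sphere_iff[OF finite_Pow_I LV card_I] by blast+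
  obtain j where "j \<in> I" "\<Psi> (y, u) j = D2_base"
    using some_coordinate_base_iff[OF yu] assms by blast
  then have "{j \<in> V. \<Psi> (y, u) j \<noteq> D2_base} \<subset> I"
    using nonbase_subset by blast
  then have "card {j \<in> V. \<Psi> (y, u) j \<noteq> D2_base} < card I"
    by (rule psubset_card_mono[OF finite_I])
  then show ?thesis
    using \<Psi>_in_moment_angle[OF yu] card_le
    by (subst in_fat_wedge_filtration_iff[OF finite_V]) auto
qed

lemma \<Psi>_interior:
  assumes "y \<in> topspace C" "u \<in> topspace D" "(y, u) \<notin> topspace (join_sphere L (card I))"
  shows "{j \<in> V. \<Psi> (y, u) j \<noteq> D2_base} = I"
  using some_coordinate_base_iff[OF assms(1,2)] assms(3) nonbase_subset I(1) by blast

text \<open>Off the join no coordinate is at the basepoint, so cone parameters and circle components can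
  be read off from the image; the former determine \<open>y\<close>, the latter \<open>u\<close>.\<close>

lemma \<Psi>_inj:
  assumes yu: "y \<in> topspace C" "u \<in> topspace D" "(y, u) \<notin> topspace (join_sphere L (card I))"
    and yu': "y' \<in> topspace C" "u' \<in> topspace D" and eq: "\<Psi> (y, u) = \<Psi> (y', u')"
  shows "y = y' \<and> u = u'"
proof -
  have coord: "cone_ic y j = cone_ic y' j \<and> q u j = q u' j \<and> q u j \<noteq> 1" if "j \<in> I" for j
  proof -
    have "\<not> (cone_ic y j = -1 \<or> q u j = 1)"
      using \<Psi>_base_iff[OF yu(1,2) that] \<Psi>_interior[OF yu] that by blast
    moreover have "D2_pt (cone_ic y j) (q u j) = D2_pt (cone_ic y' j) (q u' j)"
      using fun_cong[OF eq, of j] by (simp add: \<Psi>_apply that)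
    ultimately show ?thesis
      using D2_pt_eq_iff[OF qD(2)[OF yu(2) that] ic_range[OF yu(1)] qD(2)[OF yu'(2) that] ic_range[OF yu'(1)]]
      by blast
  qed
  have "y = y'"
    by (rule cone_ic_inj[OF finite_I KI(1) yu(1) yu'(1)]) (simp add: coord)
  moreover have "u = u'"
    by (rule qD(4)[OF yu(2) yu'(2)]) (use coord in blast)+
  ultimately show ?thesis by blast
qed

text \<open>If \<open>z\<close> lies in the block of \<open>\<sigma>\<close>, its coordinates in \<open>I - \<sigma>\<close> are on the circle and not at the
  basepoint, so their cone parameter is \<open>1\<close>.  Those with smaller parameter therefore form a simplex
  of the full subcomplex.\<close>

lemma \<Psi>_surj:
  assumes z: "z \<in> topspace (moment_angle V K)" and nonbase: "{j \<in> V. z j \<noteq> D2_base} = I"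
  obtains y u where "y \<in> topspace C" "u \<in> topspace D" "z = \<Psi> (y, u)"
proof -
  obtain \<sigma> where zE: "z \<in> (\<Pi>\<^sub>E j\<in>V. topspace D2)" and \<sigma>: "\<sigma> \<in> K" "\<And>j. j \<in> V - \<sigma> \<Longrightarrow> z j \<in> D2_circle"
    using z unfolding in_moment_angle_iff by blast
  have "\<forall>j\<in>I. \<exists>t x. t \<in> {-1..1} \<and> x \<in> sphere 0 1 \<and> z j = D2_pt t x"
  proof
    fix j assume "j \<in> I"
    then have "z j \<in> topspace D2" using zE I(1) by blast
    then obtain x t where "x \<in> sphere 0 1" "t \<in> {-1..1}" "z j = D2_pt t x"
      unfolding topspace_D2 by auto
    then show "\<exists>t x. t \<in> {-1..1} \<and> x \<in> sphere 0 1 \<and> z j = D2_pt t x"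
      by blast
  qed
  then obtain t x where tx: "\<And>j. j \<in> I \<Longrightarrow> t j \<in> {-1..1}" "\<And>j. j \<in> I \<Longrightarrow> x j \<in> sphere 0 1"
    "\<And>j. j \<in> I \<Longrightarrow> z j = D2_pt (t j) (x j)"
    by metis
  have nb: "z j \<noteq> D2_base" if "j \<in> I" for j using nonbase that by blast
  have x1: "x j \<noteq> 1" if "j \<in> I" for j
    using D2_pt_eq_base_iff[OF tx(2)[OF that] tx(1)[OF that]] nb[OF that] tx(3)[OF that] by metis
  have "j \<in> \<sigma>" if "j \<in> I" "t j < 1" for j
  proof (rule ccontr)
    assume "j \<notin> \<sigma>"
    then have "z j \<in> D2_circle" using \<sigma>(2) that I(1) by blast
    then show False
      using D2_pt_in_circle_iff[OF tx(2)[OF that(1)] tx(1)[OF that(1)]] nb[OF that(1)] that(2)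
      unfolding tx(3)[OF that(1), symmetric] by simp
  qed
  then have "{j \<in> I. t j < 1} \<subseteq> \<sigma>" by blast
  then have "{j \<in> I. t j < 1} \<in> full_subcomplex K I"
    using bspec[OF abstract_complexD(3)[OF K] \<sigma>(1)] by (simp add: full_subcomplex_def)
  moreover have "\<forall>j\<in>I. t j \<in> {-1..1}"
    using tx(1) by blast
  ultimately obtain y where y: "y \<in> topspace C" "\<forall>j\<in>I. cone_ic y j = t j"
    using cone_ic_surj[OF finite_I KI(1,3)] by blast
  have "\<forall>j\<in>I. x j \<in> sphere 0 1 \<and> x j \<noteq> 1"
    using tx(2) x1 by blast
  from qD(5)[OF this] obtain u where u: "u \<in> topspace D" "\<forall>j\<in>I. q u j = x j"
    by blast
  have "z = \<Psi> (y, u)"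
  proof (rule extensionalityI)
    show "z \<in> extensional V" using zE by (simp add: PiE_iff)
    show "\<Psi> (y, u) \<in> extensional V" by (simp add: cell_map_def base_extend_def)
    show "z j = \<Psi> (y, u) j" if "j \<in> V" for j
    proof (cases "j \<in> I")
      case True
      then show ?thesis by (simp add: \<Psi>_apply y u tx(3))
    next
      case False
      with that nonbase show ?thesis by (auto simp: \<Psi>_apply)
    qed
  qed
  with y(1) u(1) show ?thesis by (rule that)
qed

lemma continuous_\<Psi>: "continuous_map (prod_topology C D) (product_topology (\<lambda>_. D2) V) \<Psi>"
  unfolding continuous_map_componentwise
proof (intro conjI ballI)
  show "\<Psi> ` topspace (prod_topology C D) \<subseteq> extensional V"
    by (auto simp: cell_map_def base_extend_def)
  fix j assume "j \<in> V"
  show "continuous_map (prod_topology C D) D2 (\<lambda>p. \<Psi> p j)"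
  proof (cases "j \<in> I")
    case True
    have "continuous_map D S1 (\<lambda>u. q u j)"
      using continuous_map_compose[OF qD(1)[unfolded torus_def] continuous_map_product_projection[OF True]]
      by (simp add: o_def)
    then have "continuous_map (prod_topology C D) S1 (\<lambda>p. q (snd p) j)"
      using continuous_map_compose[OF continuous_map_snd] by (force simp: o_def)
    moreover have "continuous_map (prod_topology C D) (top_of_set {-1..1}) (\<lambda>p. cone_ic (fst p) j)"
      using continuous_map_compose[OF continuous_map_fst continuous_map_cone_ic[OF finite_I KI(1)]]
      by (force simp: o_def)
    ultimately have "continuous_map (prod_topology C D) D2 (\<lambda>p. D2_pt (cone_ic (fst p) j) (q (snd p) j))"
      by (rule continuous_map_D2_pt)
    then show ?thesis
      by (rule continuous_map_eq) (auto simp: \<Psi>_apply True)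
  next
    case False
    then have "\<Psi> p j = D2_base" for p
      using \<Psi>_apply(2)[of j "fst p" "snd p"] \<open>j \<in> V\<close> by simp
    then show ?thesis
      using D2_base_in_D2 by (simp add: continuous_map_const)
  qed
qed

text \<open>At \<open>s = 0\<close> this is the attaching map and at \<open>s = 1\<close> it is constant, so it is a map on the cone
  over the join.\<close>

definition cone_char ::
    "((nat set option \<Rightarrow> real) \<times> (nat \<Rightarrow> real)) \<times> real \<Rightarrow> nat \<Rightarrow> (complex \<times> real) set" where
  "cone_char = (\<lambda>((y, u), s). \<Psi> (toward_apex s y, toward_center s u))"

abbreviation "J \<equiv> join_sphere L (card I)"

lemma toward_in:
  assumes "(y, u) \<in> topspace J" "s \<in> {0..1}"
  shows "toward_apex s y \<in> topspace C" "toward_center s u \<in> topspace D"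
  using assms(1) toward_apex_in_cone[OF finite_Pow_I LV Sd_facts(2)[OF KI(1)] _ assms(2)]
    toward_center_in_disc[OF _ assms(2)]
  unfolding in_join_sphere_iff[OF finite_Pow_I LV card_I] by blast+

lemma toward_off_join:
  assumes "(y, u) \<in> topspace J" "0 < s" "s \<le> 1"
  shows "(toward_apex s y, toward_center s u) \<notin> topspace J"
proof
  assume "(toward_apex s y, toward_center s u) \<in> topspace J"
  then have "(1 - s) * cone_disc_radius (card I) y u = 1"
    using cone_disc_radius_join_sphere[OF finite_Pow_I LV card_I] cone_disc_radius_toward[OF assms(3)] by metis
  with cone_disc_radius_join_sphere[OF finite_Pow_I LV card_I assms(1)] assms(2) show False by simp
qed

lemma continuous_cone_char:
  "continuous_map (prod_topology J (top_of_set {0..1})) (fat_wedge_filtration V K (card I)) cone_char"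
proof -
  let ?P = "prod_topology J (top_of_set {0..1::real})"
  have s: "continuous_map ?P euclideanreal snd"
    using continuous_map_snd[of J "top_of_set {0..1::real}"] by (simp add: continuous_map_in_subtopology)
  have J: "continuous_map ?P (prod_topology C D) fst"
    using continuous_map_fst[of J "top_of_set {0..1::real}"] unfolding join_sphere_def
    by (simp add: continuous_map_in_subtopology)
  have y: "continuous_map ?P euclideanreal (\<lambda>p. fst (fst p) v)" for v
    using continuous_map_compose[OF continuous_map_compose[OF J continuous_map_fst] continuous_map_realization_coordinate]
    by (simp add: o_def)
  have "continuous_map D euclideanreal (\<lambda>u. u k)" for k
    by (subst disc_eq) (auto intro: continuous_map_from_subtopology continuous_map_product_projection)
  then have u: "continuous_map ?P euclideanreal (\<lambda>p. snd (fst p) k)" for k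
    using continuous_map_compose[OF continuous_map_compose[OF J continuous_map_snd]]
    by (force simp: o_def)
  have "continuous_map ?P C (\<lambda>p. toward_apex (snd p) (fst (fst p)))"
  proof -
    have "continuous_map ?P euclideanreal (\<lambda>p. toward_apex (snd p) (fst (fst p)) v)" for v
      unfolding toward_apex_def
      by (cases v) (auto intro!: continuous_map_add continuous_map_real_mult continuous_map_diff s y)
    moreover have "toward_apex (snd p) (fst (fst p)) \<in> topspace C" if "p \<in> topspace ?P" for p
      using that toward_in(1)[of "fst (fst p)" "snd (fst p)" "snd p"] by auto
    ultimately show ?thesis
      by (subst realization_eq)
        (simp add: continuous_map_in_subtopology continuous_map_componentwise_UNIV Pi_iff)
  qed
  moreover have "continuous_map ?P D (\<lambda>p. toward_center (snd p) (snd (fst p)))"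
  proof -
    have "continuous_map ?P euclideanreal (\<lambda>p. toward_center (snd p) (snd (fst p)) k)" for k
      unfolding toward_center_def
      by (auto intro!: continuous_map_real_mult continuous_map_diff s u)
    moreover have "toward_center (snd p) (snd (fst p)) \<in> topspace D" if "p \<in> topspace ?P" for p
      using that toward_in(2)[of "fst (fst p)" "snd (fst p)" "snd p"] by auto
    ultimately show ?thesis
      by (subst disc_eq)
        (simp add: continuous_map_in_subtopology continuous_map_componentwise_UNIV Pi_iff)
  qed
  ultimately have "continuous_map ?P (prod_topology C D)
      (\<lambda>p. (toward_apex (snd p) (fst (fst p)), toward_center (snd p) (snd (fst p))))"
    by (rule continuous_map_pairedI)
  from continuous_map_compose[OF this continuous_\<Psi>]
  have "continuous_map ?P (product_topology (\<lambda>_. D2) V) cone_char"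
    by (simp add: cone_char_def o_def case_prod_beta')
  then show ?thesis
    using \<Psi>_in_filtration[OF toward_in]
    by (subst fat_wedge_filtration_eq) (auto simp: continuous_map_in_subtopology cone_char_def)
qed

lemma continuous_attaching_map:
  "continuous_map J (fat_wedge_filtration V K (card I - 1)) \<Psi>"
proof -
  have "continuous_map J (product_topology (\<lambda>_. D2) V) \<Psi>"
    unfolding join_sphere_def by (rule continuous_map_from_subtopology[OF continuous_\<Psi>])
  then show ?thesis
    using \<Psi>_boundary by (subst fat_wedge_filtration_eq) (auto simp: continuous_map_in_subtopology)
qed

lemma cone_char_interior:
  assumes "a \<in> topspace J" "0 < s" "s \<le> 1"
  shows "{j \<in> V. cone_char (a, s) j \<noteq> D2_base} = I"
  using assms toward_in[of "fst a" "snd a" s] toward_off_join[of "fst a" "snd a" s]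
  by (simp add: cone_char_def case_prod_beta' \<Psi>_interior)

lemma cone_char_inj:
  assumes "a \<in> topspace J" "b \<in> topspace J" "0 < s" "s \<le> 1" "0 < t" "t \<le> 1"
    and "cone_char (a, s) = cone_char (b, t)"
  shows "s = t \<and> (a = b \<or> s = 1)"
proof -
  obtain y u y' u' where ab: "a = (y, u)" "b = (y', u')"
    by (metis surj_pair)
  have "toward_apex s y = toward_apex t y' \<and> toward_center s u = toward_center t u'"
    using assms toward_in[of y u s] toward_in[of y' u' t] toward_off_join[of y u s]
    unfolding ab cone_char_def by (intro \<Psi>_inj) auto
  then show ?thesis
    using toward_inj[OF finite_Pow_I LV card_I, of y u y' u' s t] assms ab by blast
qed

lemma cone_char_surj:
  assumes "z \<in> topspace (moment_angle V K)" "{j \<in> V. z j \<noteq> D2_base} = I"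
  shows "z \<in> cone_char ` (topspace J \<times> {0..1})"
proof -
  obtain y u where yu: "y \<in> topspace C" "u \<in> topspace D" and z: "z = \<Psi> (y, u)"
    using \<Psi>_surj[OF assms] by blast
  obtain y' u' s where "(y', u') \<in> topspace J" "s \<in> {0..1}" "toward_apex s y' = y" "toward_center s u' = u"
    using toward_surj[OF finite_Pow_I LV Sd_facts(2)[OF KI(1)] card_I yu] by blast
  then show ?thesis
    unfolding z by (intro image_eqI[of _ _ "((y', u'), s)"]) (auto simp: cone_char_def)
qed

lemma cone_char_ends:
  shows "cone_char (a, 0) = \<Psi> a" "cone_char (a, 1) = cone_char (b, 1)"
proof -
  obtain y u y' u' where ab: "a = (y, u)" "b = (y', u')"
    by (metis surj_pair)
  have "toward_apex 1 y = toward_apex 1 y'" "toward_center 1 u = toward_center 1 u'"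
    by (simp_all add: toward_apex_def toward_center_def)
  then show "cone_char (a, 1) = cone_char (b, 1)"
    by (simp add: cone_char_def ab)
qed (cases a, simp add: cone_char_def)

lemma compact_J: "compact_space J"
  by (rule compact_space_join_sphere[OF finite_Pow_I LV Sd_facts(3)[OF KI(1)] card_I])

end

section \<open>The attachment\<close>

theorem theorem5p1:
  fixes m i :: nat and K :: "nat set set"
    and q :: "nat set \<Rightarrow> (nat \<Rightarrow> real) \<Rightarrow> nat \<Rightarrow> complex"
  assumes "m \<ge> 1"
    and "abstract_complex {1..m} K"
    and "\<And>I. \<lbrakk>I \<subseteq> {1..m}; I \<noteq> {}\<rbrakk> \<Longrightarrow> top_cell_map I (q I)"
    and "1 \<le> i" and "i \<le> m"
  shows "obtained_by_attaching_cones
           (fat_wedge_filtration {1..m} K i)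
           (fat_wedge_filtration {1..m} K (i - 1))
           {I. I \<subseteq> {1..m} \<and> card I = i}
           (\<lambda>I. join_sphere (Sd (full_subcomplex K I)) i)
           (\<lambda>I. base_extend I {1..m} \<circ> phi_hat I (q I))"
proof -
  let ?V = "{1..m}"
  let ?J = "{I. I \<subseteq> ?V \<and> card I = i}"
  \<comment> \<open>Points of the difference of the two stages have exactly \<open>i\<close> coordinates off the basepoint,
    and the set of these coordinates tells to which cone the point belongs.\<close>
  let ?F = "\<lambda>I. cell.cone_char ?V I (q I)"
  have cell: "cell ?V I K (q I)" if "I \<in> ?J" for I
  proof -
    have "I \<noteq> {}" using that assms(4) by auto
    with that assms show ?thesis by unfold_locales auto
  qed
  have le: "i \<le> card ?V" "i - 1 \<le> card ?V" using assms(5) by auto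
  note in_Z = in_fat_wedge_filtration_iff[OF finite_atLeastAtMost le(1)]
    and in_X = in_fat_wedge_filtration_iff[OF finite_atLeastAtMost le(2)]
  have "obtained_by_attaching_cones (fat_wedge_filtration ?V K i) (fat_wedge_filtration ?V K (i - 1)) ?J
      (\<lambda>I. join_sphere (Sd (full_subcomplex K I)) i) (\<lambda>I. cell_map ?V I (q I))"
  proof (rule obtained_by_attaching_conesI[where F = ?F])
    show "finite ?J" by (rule finite_subset[of _ "Pow ?V"]) auto
    show "compact_space (fat_wedge_filtration ?V K (i - 1))"
      using abstract_complexD(1)[OF assms(2)] le(2) by (intro compact_fat_wedge_filtration) auto
    show "Hausdorff_space (fat_wedge_filtration ?V K i)"
      by (rule Hausdorff_fat_wedge_filtration)
    have "topspace (fat_wedge_filtration ?V K (i - 1)) \<subseteq> topspace (fat_wedge_filtration ?V K i)"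
      unfolding in_Z in_X subset_iff by auto
    then show "continuous_map (fat_wedge_filtration ?V K (i - 1)) (fat_wedge_filtration ?V K i) (\<lambda>x. x)"
      by (subst (1 2) fat_wedge_filtration_eq)
        (auto simp: continuous_map_in_subtopology intro: continuous_map_from_subtopology)
    show "topspace (fat_wedge_filtration ?V K i) \<subseteq> topspace (fat_wedge_filtration ?V K (i - 1)) \<union>
        (\<Union>I\<in>?J. ?F I ` (topspace (join_sphere (Sd (full_subcomplex K I)) i) \<times> {0..1}))"
    proof
      fix z assume "z \<in> topspace (fat_wedge_filtration ?V K i)"
      then have z: "z \<in> topspace (moment_angle ?V K)" and card: "card {j \<in> ?V. z j \<noteq> D2_base} \<le> i"
        unfolding in_Z by blast+
      let ?I = "{j \<in> ?V. z j \<noteq> D2_base}"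
      show "z \<in> topspace (fat_wedge_filtration ?V K (i - 1)) \<union>
          (\<Union>I\<in>?J. ?F I ` (topspace (join_sphere (Sd (full_subcomplex K I)) i) \<times> {0..1}))"
      proof (cases "card ?I = i")
        case True
        then have I: "?I \<in> ?J" by auto
        have "z \<in> ?F ?I ` (topspace (join_sphere (Sd (full_subcomplex K ?I)) i) \<times> {0..1})"
          using cell.cone_char_surj[OF cell[OF I] z refl] True by simp
        with I show ?thesis by blast
      next
        case False
        with card have "card ?I \<le> i - 1" by linarith
        with z show ?thesis unfolding Un_iff in_X by blast
      qed
    qed
  next
    fix I assume I: "I \<in> ?J"
    then have card: "card I = i" by simp
    note cell.continuous_attaching_map[OF cell[OF I]] cell.continuous_cone_char[OF cell[OF I]]
      cell.compact_J[OF cell[OF I]]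
    note this[unfolded card]
    then show "compact_space (join_sphere (Sd (full_subcomplex K I)) i)"
      "continuous_map (join_sphere (Sd (full_subcomplex K I)) i) (fat_wedge_filtration ?V K (i - 1)) (cell_map ?V I (q I))"
      "continuous_map (prod_topology (join_sphere (Sd (full_subcomplex K I)) i) (top_of_set {0..1}))
        (fat_wedge_filtration ?V K i) (?F I)"
      by blast+
    show "?F I (a, 0) = cell_map ?V I (q I) a" "?F I (a, 1) = ?F I (b, 1)" for a b
      by (rule cell.cone_char_ends[OF cell[OF I]])+
    show "?F I (a, s) \<notin> topspace (fat_wedge_filtration ?V K (i - 1))"
      if "a \<in> topspace (join_sphere (Sd (full_subcomplex K I)) i)" "0 < s" "s \<le> 1" for a s
    proof -
      have "\<not> card I \<le> i - 1" using card assms(4) by simp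
      then show ?thesis
        unfolding in_X cell.cone_char_interior[OF cell[OF I], unfolded card, OF that] by blast
    qed
  next
    fix I I' a b s t
    assume I: "I \<in> ?J" "I' \<in> ?J"
      and a: "a \<in> topspace (join_sphere (Sd (full_subcomplex K I)) i)"
      and b: "b \<in> topspace (join_sphere (Sd (full_subcomplex K I')) i)"
      and st: "0 < s" "s \<le> 1" "0 < t" "t \<le> 1" and eq: "?F I (a, s) = ?F I' (b, t)"
    have card: "card I = i" "card I' = i" using I by auto
    have "I = I'"
      using cell.cone_char_interior[OF cell[OF I(1)], unfolded card, OF a st(1,2)]
        cell.cone_char_interior[OF cell[OF I(2)], unfolded card, OF b st(3,4)] eq by simp
    with cell.cone_char_inj[OF cell[OF I(1)], unfolded card, OF a _ st] b eq
    show "I = I' \<and> s = t \<and> (a = b \<or> s = 1)" by blast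
  qed
  then show ?thesis by (simp only: cell_map_def)
qed

end
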